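(* Let $\kappa$ be a positive integer with $\kappa\le4$, let $n=\kappa^2+1$, and let $A$ be an $n\times n$ $(0,1)$-matrix with all row and column sums equal to $\kappa$ such that $\Theta^m(A)=A$ for some integer $m\ge1$. Then: (i) $A$ is p-equivalent to a standard form $S(P)$ in which each block $P_{ij}$ ($1\le i,j\le\kappa$) of $P$ is a $(0,1)$-matrix with at most one entry $1$ in each row and in each column; (ii) for such a $P$, if some block $P_{ij}$ is the zero matrix, then all other blocks $P_{ij'}$ ($j'\neq j$) in the same block row and all other blocks $P_{i'j}$ ($i'\ne i$) in the same block column are permutation matrices; (iii) if such a $P$ has a zero block on its block diagonal, then $A$ is p-equivalent to a standard form $S(P')$ with $P'_{11}$ the zero matrix of order $\kappa-1$ and $P'_{1i}=P'_{i1}=I_{\kappa-1}$ for all $i=2,\dots,\kappa$.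
   Context: For an $n\times n$ integer matrix $X$ whose row and column sums all equal an integer $\lambda$, define $\Theta(X):=(\lambda-1)I_n+J_n-XX^{\mathrm T}$, where $I_n$ is the identity and $J_n$ the all-one matrix of order $n$; $\Theta(X)$ again has constant row and column sums, and $\Theta^m$ denotes the $m$-fold iterate, each application using the common row/column sum of its argument. Matrices $M_1,M_2$ of order $r$ are p-equivalent if $M_2=S^{-1}M_1S$ for a permutation matrix $S$. Let $\mathbf{0}_\nu,\mathbf{1}_\nu$ be the all-zero and all-one row vectors of length $\nu$, $\mathbf{0}_{\kappa,\kappa}$ the zero matrix of order $\kappa$, and $K=I_\kappa\otimes\mathbf{1}_{\kappa-1}$ (a $\kappa\times(\kappa^2-\kappa)$ matrix whose $i$-th row has ones exactly in columns $(i-1)(\kappa-1)+1,\dots,i(\kappa-1)$). A standard form is a matrix $$S(P)=\begin{pmatrix}0&\mathbf{1}_\kappa&\mathbf{0}_{\kappa^2-\kappa}\\ \mathbf{1}_\kappa^{\mathrm T}&\mathbf{0}_{\kappa,\kappa}&K\\ \mathbf{0}_{\kappa^2-\kappa}^{\mathrm T}&K^{\mathrm T}&P\end{pmatrix}$$ where $P$ is a symmetric $(0,1)$-matrix of order $\kappa^2-\kappa$ with all row and column sums equal to $\kappa-1$, regarded as a $\kappa\times\kappa$ block matrix $P=(P_{ij})$ with square blocks of order $\kappa-1$. *)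

theory Defs
  imports "Jordan_Normal_Form.Matrix"
begin

text \<open>Rows, columns and blocks are indexed from 0.\<close>

abbreviation ones_mat :: "nat \<Rightarrow> nat \<Rightarrow> int mat" where
  "ones_mat nr nc \<equiv> mat nr nc (\<lambda>_. 1)"

definition zero_one_mat :: "int mat \<Rightarrow> bool" where
  "zero_one_mat X \<longleftrightarrow> elements_mat X \<subseteq> {0, 1}"

definition has_const_sums :: "int mat \<Rightarrow> int \<Rightarrow> bool" where
  "has_const_sums X c \<longleftrightarrow>
     (\<forall>i < dim_row X. (\<Sum>j < dim_col X. X $$ (i, j)) = c) \<and>
     (\<forall>j < dim_col X. (\<Sum>i < dim_row X. X $$ (i, j)) = c)"

text \<open>Meaningful only for a nonempty square matrix with constant row and column sums.\<close>

definition common_sum :: "int mat \<Rightarrow> int" where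
  "common_sum X = (THE c. has_const_sums X c)"

lemma common_sum_eq:
  assumes "has_const_sums X c" and "dim_row X > 0"
  shows "common_sum X = c"
  unfolding common_sum_def
  by (rule the_equality) (use assms in \<open>auto simp: has_const_sums_def\<close>)

definition Theta :: "int mat \<Rightarrow> int mat" where
  "Theta X = (let n = dim_row X in
     (common_sum X - 1) \<cdot>\<^sub>m 1\<^sub>m n + ones_mat n n - X * transpose_mat X)"

definition permutation_mat :: "nat \<Rightarrow> int mat \<Rightarrow> bool" where
  "permutation_mat r S \<longleftrightarrow> S \<in> carrier_mat r r \<and> zero_one_mat S \<and> has_const_sums S 1"

text \<open>In \<open>similar_mat_wit M\<^sub>2 M\<^sub>1 T S\<close> the matrix \<open>T\<close> is the two-sided inverse of \<open>S\<close>,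
  so this says that \<open>M\<^sub>2\<close> is the conjugate of \<open>M\<^sub>1\<close> by \<open>S\<close> (inverse of \<open>S\<close> on the left).\<close>

definition p_equivalent :: "int mat \<Rightarrow> int mat \<Rightarrow> bool" where
  "p_equivalent M\<^sub>1 M\<^sub>2 \<longleftrightarrow>
     (\<exists>S T. permutation_mat (dim_row M\<^sub>1) S \<and> similar_mat_wit M\<^sub>2 M\<^sub>1 T S)"

text \<open>The Kronecker product of the identity of order \<open>k\<close> with the all-one row vector
  of length \<open>k - 1\<close>.\<close>

definition K_mat :: "nat \<Rightarrow> int mat" where
  "K_mat k = mat k (k^2 - k)
     (\<lambda>(i, j). if i * (k - 1) \<le> j \<and> j < (i + 1) * (k - 1) then 1 else 0)"

text \<open>The upper left block of the outer partition has order \<open>1 + k\<close>.\<close>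

definition std_form :: "nat \<Rightarrow> int mat \<Rightarrow> int mat" where
  "std_form k P = four_block_mat
     (four_block_mat (0\<^sub>m 1 1) (ones_mat 1 k) (transpose_mat (ones_mat 1 k)) (0\<^sub>m k k))
     (0\<^sub>m 1 (k^2 - k) @\<^sub>r K_mat k)
     (transpose_mat (0\<^sub>m 1 (k^2 - k) @\<^sub>r K_mat k))
     P"

text \<open>The matrices \<open>P\<close> for which \<open>std_form k P\<close> counts as a standard form.\<close>

definition std_param :: "nat \<Rightarrow> int mat \<Rightarrow> bool" where
  "std_param k P \<longleftrightarrow> P \<in> carrier_mat (k^2 - k) (k^2 - k) \<and> transpose_mat P = P \<and>
     zero_one_mat P \<and> has_const_sums P (int k - 1)"

definition block :: "nat \<Rightarrow> int mat \<Rightarrow> nat \<Rightarrow> nat \<Rightarrow> int mat" where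
  "block k P i j = mat (k - 1) (k - 1)
     (\<lambda>(a, b). P $$ (i * (k - 1) + a, j * (k - 1) + b))"

definition partial_permutation_mat :: "int mat \<Rightarrow> bool" where
  "partial_permutation_mat B \<longleftrightarrow> zero_one_mat B \<and>
     (\<forall>i < dim_row B. card {j. j < dim_col B \<and> B $$ (i, j) = 1} \<le> 1) \<and>
     (\<forall>j < dim_col B. card {i. i < dim_row B \<and> B $$ (i, j) = 1} \<le> 1)"

text \<open>\<open>A\<close> is p-equivalent to the standard form of \<open>P\<close>, and no block of \<open>P\<close> has two ones
  in the same row or column.\<close>

definition block_std_form_of :: "nat \<Rightarrow> int mat \<Rightarrow> int mat \<Rightarrow> bool" where
  "block_std_form_of k A P \<longleftrightarrow> std_param k P \<and> p_equivalent A (std_form k P) \<and>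
     (\<forall>i < k. \<forall>j < k. partial_permutation_mat (block k P i j))"

end

(* Every matrix Theta X has a diagonal with entries c - (sum of squares of a row of X), which is
   nonpositive and vanishes exactly if the row is (0,1).  Running backwards along the periodic orbit
   of A, every iterate is therefore a symmetric (0,1)-matrix with zero diagonal, that is, a graph.
   Off the diagonal Theta X is 1 - X X^T, so in all these graphs two vertices have at most one common
   neighbour (no 4-cycles), and Theta joins exactly the pairs without a common neighbour.
   A standard form of A is the same as a vertex that lies in no triangle.  If every vertex were in a
   triangle, then for k = 2, 3 each vertex would be in exactly one, so 3 would divide k^2 + 1.  For
   k = 4 every vertex would be in one or two triangles, and since 3 does not divide 2 * 17 some vertex
   v is in exactly one.  The neighbours of v in the graph of Theta A are then its two neighbours
   outside the triangle and the two vertices at distance three, and absence of 4-cycles through v in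
   the graph of Theta A contradicts absence of 4-cycles in A by a finite propositional argument.
   The statements on zero blocks follow from counting ones in block rows; the last one renumbers the
   blocks and the positions inside each block. *)

theory Submission
  imports Defs
begin

section \<open>The orbit of \<open>\<Theta>\<close>\<close>

lemma Theta_carrier: "X \<in> carrier_mat n n \<Longrightarrow> Theta X \<in> carrier_mat n n"
  unfolding Theta_def Let_def by (intro minus_carrier_mat mult_carrier_mat) auto

lemma Theta_index:
  assumes "X \<in> carrier_mat n n" and "has_const_sums X c" and "i < n" and "j < n"
  shows "Theta X $$ (i, j) = (if i = j then c else 1) - (\<Sum>l<n. X $$ (i, l) * X $$ (j, l))"
proof -
  have "common_sum X = c"
    using assms by (intro common_sum_eq) auto
  then show ?thesis
    using assms by (auto simp: Theta_def Let_def scalar_prod_def lessThan_atLeast0)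
qed

lemma Theta_symmetric:
  assumes "X \<in> carrier_mat n n" and "has_const_sums X c" and "i < n" and "j < n"
  shows "Theta X $$ (i, j) = Theta X $$ (j, i)"
  using assms by (simp add: Theta_index mult.commute)

text \<open>Exchanging summations shows that every row of \<open>X * transpose_mat X\<close> sums to
  \<open>c * c\<close>. A row of \<open>Theta X\<close> therefore sums to
  \<open>c - 1 + n - c * c\<close>, which the order \<open>n = c^2 + 1\<close> turns back into
  \<open>c\<close>; columns follow by symmetry.\<close>

lemma Theta_const_sums:
  assumes X: "X \<in> carrier_mat n n" and c: "has_const_sums X c" and n: "int n = c^2 + 1"
  shows "has_const_sums (Theta X) c"
proof -
  have row: "(\<Sum>j<n. Theta X $$ (i, j)) = c" if i: "i < n" for i
  proof -
    have "(\<Sum>j<n. Theta X $$ (i, j)) = (\<Sum>j<n. (if i = j then c - 1 else 0) + 1 - (\<Sum>l<n. X $$ (i, l) * X $$ (j, l)))"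
      by (intro sum.cong) (use i Theta_index[OF X c] in auto)
    also have "\<dots> = c - 1 + int n - (\<Sum>j<n. \<Sum>l<n. X $$ (i, l) * X $$ (j, l))"
      using i by (simp add: sum.distrib sum_subtractf)
    also have "(\<Sum>j<n. \<Sum>l<n. X $$ (i, l) * X $$ (j, l)) = (\<Sum>l<n. X $$ (i, l) * (\<Sum>j<n. X $$ (j, l)))"
      by (subst sum.swap) (simp add: sum_distrib_left)
    also have "\<dots> = (\<Sum>l<n. X $$ (i, l) * c)"
      using X c by (intro sum.cong) (auto simp: has_const_sums_def)
    also have "\<dots> = c * c"
      using X c i by (auto simp: has_const_sums_def simp flip: sum_distrib_right)
    finally show ?thesis
      using n by (simp add: power2_eq_square)
  qed
  moreover have "(\<Sum>i<n. Theta X $$ (i, j)) = c" if "j < n" for j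
    using row[OF that] by (subst sum.cong[OF refl Theta_symmetric[OF X c]]) (use that in auto)
  ultimately show ?thesis
    using Theta_carrier[OF X] by (auto simp: has_const_sums_def)
qed

lemma zero_one_mat_iff:
  "X \<in> carrier_mat nr nc \<Longrightarrow> zero_one_mat X \<longleftrightarrow> (\<forall>i<nr. \<forall>j<nc. X $$ (i, j) = 0 \<or> X $$ (i, j) = 1)"
  by (fastforce simp: zero_one_mat_def elements_mat_def subset_iff)

lemma self_le_square: "(x::int) \<le> x * x"
  by (metis mult_le_cancel_left1 not_less linorder_le_cases mult.right_neutral zero_le_mult_iff zero_le_square int_one_le_iff_zero_less order_le_less order.trans)

text \<open>Writing \<open>c\<close> as the sum of row \<open>i\<close> turns the diagonal entry
  into minus the sum of the terms \<open>x * x - x\<close>. For integers these are nonnegative and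
  vanish only at 0 and 1.\<close>

lemma Theta_diag:
  assumes X: "X \<in> carrier_mat n n" and c: "has_const_sums X c" and i: "i < n"
  shows "Theta X $$ (i, i) \<le> 0"
    and "Theta X $$ (i, i) = 0 \<longleftrightarrow> (\<forall>l<n. X $$ (i, l) = 0 \<or> X $$ (i, l) = 1)"
proof -
  have nonneg: "0 \<le> X $$ (i, l) * X $$ (i, l) - X $$ (i, l)" for l
    using self_le_square[of "X $$ (i, l)"] by simp
  have "c = (\<Sum>l<n. X $$ (i, l))"
    using X c i by (auto simp: has_const_sums_def)
  then have eq: "Theta X $$ (i, i) = - (\<Sum>l<n. X $$ (i, l) * X $$ (i, l) - X $$ (i, l))"
    using Theta_index[OF X c i i] by (simp add: sum_subtractf)
  show "Theta X $$ (i, i) \<le> 0"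
    unfolding eq using nonneg by (simp add: sum_nonneg del: diff_ge_0_iff_ge)
  have "Theta X $$ (i, i) = 0 \<longleftrightarrow> (\<forall>l\<in>{..<n}. X $$ (i, l) * X $$ (i, l) - X $$ (i, l) = 0)"
    unfolding eq neg_equal_0_iff_equal using nonneg by (intro sum_nonneg_eq_0_iff) auto
  then show "Theta X $$ (i, i) = 0 \<longleftrightarrow> (\<forall>l<n. X $$ (i, l) = 0 \<or> X $$ (i, l) = 1)"
    by auto
qed

lemma Theta_orbit_carrier:
  assumes "A \<in> carrier_mat n n" and "has_const_sums A c" and "int n = c^2 + 1"
  shows "(Theta ^^ j) A \<in> carrier_mat n n \<and> has_const_sums ((Theta ^^ j) A) c"
  by (induction j) (use assms Theta_carrier Theta_const_sums in auto)

text \<open>The property passes from an iterate to its predecessor, so it is enough to have it late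
  in the orbit; periodicity provides it at \<open>m * j\<close>, which is at least
  \<open>j\<close>.\<close>

lemma periodic_orbit_zero_one:
  assumes A: "A \<in> carrier_mat n n" "has_const_sums A c" "int n = c^2 + 1" "zero_one_mat A"
    and m: "m \<ge> 1" "(Theta ^^ m) A = A"
  shows "zero_one_mat ((Theta ^^ j) A)"
proof -
  note orbit = Theta_orbit_carrier[OF A(1-3)]
  have "(Theta ^^ (m * q)) A = A" for q
    by (induction q) (use m in \<open>simp_all add: funpow_add\<close>)
  then have "zero_one_mat ((Theta ^^ (m * j)) A)"
    using A by simp
  moreover have "zero_one_mat ((Theta ^^ i) A)" if "zero_one_mat ((Theta ^^ Suc i) A)" for i
  proof -
    note X = orbit[of i, THEN conjunct1] orbit[of i, THEN conjunct2]
    \<comment> \<open>A diagonal entry of the successor is 0 or 1 by assumption and at most 0 by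
      \<open>Theta_diag\<close>.\<close>
    have "Theta ((Theta ^^ i) A) $$ (x, x) = 0" if "x < n" for x
      using \<open>zero_one_mat ((Theta ^^ Suc i) A)\<close> that orbit[of "Suc i"] Theta_diag(1)[OF X that]
      by (force simp: zero_one_mat_iff)
    then show ?thesis
      using Theta_diag(2)[OF X] by (simp add: zero_one_mat_iff[OF X(1)])
  qed
  ultimately show ?thesis
    using m by (intro inc_induct[of j "m * j" "\<lambda>i. zero_one_mat ((Theta ^^ i) A)"]) auto
qed

section \<open>Regular graphs without 4-cycles\<close>

text \<open>Vertex 0 is in the single triangle 0, 1, 2; its other neighbours 3 and 4 are in the triangles
  3, 9, 10 and 4, 12, 13, and 15 and 16 are the vertices at distance three from 0. Assumption
  \<open>link\<close> excludes 4-cycles through 0 in the graph of \<open>\<Theta>\<close>, where 0 has the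
  neighbours 3, 4, 15, 16.\<close>

lemma no_quartic_configuration:
  fixes e :: "nat \<Rightarrow> nat \<Rightarrow> bool"
  assumes sym: "\<And>x y. e x y = e y x"
    and irr: "\<And>x. \<not> e x x"
    and c4: "\<And>x y z w. \<lbrakk>x < 17; y < 17; z < 17; w < 17; x \<noteq> z; y \<noteq> w; e x y; e y z; e z w; e w x\<rbrakk> \<Longrightarrow> False"
    and deg: "\<And>x. x < 17 \<Longrightarrow> card {y. y < 17 \<and> e x y} = 4"
    and star: "e 0 1" "e 0 2" "e 0 3" "e 0 4" "e 1 2" "e 1 5" "e 1 6" "e 2 7" "e 2 8"
      "e 3 9" "e 3 10" "e 3 11" "e 4 12" "e 4 13" "e 4 14" "e 9 10" "e 12 13"
    and tri: "\<exists>a<17. \<exists>b<17. a < b \<and> e 11 a \<and> e 11 b \<and> e a b"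
    and link: "\<And>x u w. \<lbrakk>0 < x; x < 17; u \<in> {3, 4, 15, 16}; w \<in> {3, 4, 15, 16}; u \<noteq> w; x \<noteq> u; x \<noteq> w\<rbrakk>
      \<Longrightarrow> \<exists>k<17. e x k \<and> (e u k \<or> e w k)"
  shows False
proof -
  have ord: "e x y = e y x" if "y < x" for x y
    by (rule sym)
  \<comment> \<open>Every degree is 4, so four known neighbours are all of them.\<close>
  have full: "e x y \<longleftrightarrow> y \<in> Y" if "Y \<subseteq> {y. y < 17 \<and> e x y}" "card Y = 4" "x < 17" "y < 17" for x y Y
    using card_seteq[OF _ that(1)] deg[OF that(3)] that by auto
  have N0: "e 0 y \<longleftrightarrow> y \<in> {1, 2, 3, 4}" if "y < 17" for y
    by (rule full) (use star that in \<open>auto\<close>)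
  have N1: "e 1 y \<longleftrightarrow> y \<in> {0, 2, 5, 6}" if "y < 17" for y
    by (rule full) (use star that ord in \<open>auto\<close>)
  have N2: "e 2 y \<longleftrightarrow> y \<in> {0, 1, 7, 8}" if "y < 17" for y
    by (rule full) (use star that ord in \<open>auto\<close>)
  have N3: "e 3 y \<longleftrightarrow> y \<in> {0, 9, 10, 11}" if "y < 17" for y
    by (rule full) (use star that ord in \<open>auto\<close>)
  have N4: "e 4 y \<longleftrightarrow> y \<in> {0, 12, 13, 14}" if "y < 17" for y
    by (rule full) (use star that ord in \<open>auto\<close>)
  note N = N0 N1 N2 N3 N4 N1[unfolded One_nat_def]
  \<comment> \<open>Two neighbours of \<open>p\<close> that share a further neighbour
    \<open>c\<close> would give the 4-cycle \<open>p a c b\<close>.\<close>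
  have siblings: "\<not> (e a c \<and> e b c)" if "e p a" "e p b" "a < b" "b < 17" "c < 17" "c \<noteq> p" "p < 17" for p a b c
    using c4[of p a c b] that sym[of b p] sym[of b c] by auto
  have pairs: "\<forall>(a, b)\<in>{(5, 6), (7, 8), (9, 10), (9, 11), (10, 11), (12, 13), (12, 14), (13, 14)}.
      \<forall>c\<in>{5..<17}. \<not> (e a c \<and> e b c)"
    using siblings[of 1 5 6] siblings[of 2 7 8] siblings[of 3 9 10] siblings[of 3 9 11] siblings[of 3 10 11]
      siblings[of 4 12 13] siblings[of 4 12 14] siblings[of 4 13 14] star by auto
  \<comment> \<open>Each of these edges would close a 4-cycle containing one of the edges 1-2, 9-10
    and 12-13.\<close>
  have nonedges: "\<not> e 5 7" "\<not> e 5 8" "\<not> e 6 7" "\<not> e 6 8" "\<not> e 9 11" "\<not> e 10 11" "\<not> e 12 14" "\<not> e 13 14"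
    using c4[of 1 5 7 2] c4[of 1 5 8 2] c4[of 1 6 7 2] c4[of 1 6 8 2] siblings[of 3 10 11 9] siblings[of 3 9 11 10]
      siblings[of 4 12 14 13] siblings[of 4 13 14 12] star
      sym[of 2 1] sym[of 7 2] sym[of 8 2] sym[of 10 9] sym[of 11 9] sym[of 11 10] sym[of 13 12] sym[of 14 12] sym[of 14 13]
    by auto
  \<comment> \<open>Four vertices carry three possible 4-cycles; ordering them as
    \<open>i < j < k < l\<close> lists each cycle once.\<close>
  have quads: "\<forall>i\<in>{5..<17}. \<forall>j\<in>{Suc i..<17}. \<forall>k\<in>{Suc j..<17}. \<forall>l\<in>{Suc k..<17}.
      \<not> (e i j \<and> e j k \<and> e k l \<and> e i l) \<and> \<not> (e i j \<and> e j l \<and> e k l \<and> e i k) \<and>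
      \<not> (e i k \<and> e j k \<and> e j l \<and> e i l)"
  proof (intro ballI)
    fix i j k l
    assume "i \<in> {5..<17}" "j \<in> {Suc i..<17}" "k \<in> {Suc j..<17}" "l \<in> {Suc k..<17}"
    then have "i < j" "j < k" "k < l" "l < 17"
      by auto
    then show "\<not> (e i j \<and> e j k \<and> e k l \<and> e i l) \<and> \<not> (e i j \<and> e j l \<and> e k l \<and> e i k) \<and>
      \<not> (e i k \<and> e j k \<and> e j l \<and> e i l)"
      using c4[of i j k l] c4[of i j l k] c4[of i k j l] sym[of j k] sym[of k l] sym[of i l] sym[of i k] by auto
  qed
  \<comment> \<open>Degree 4 in propositional form: no three vertices exhaust a
    neighbourhood.\<close>
  have deg3: "\<exists>y\<in>{0..<17}. y \<notin> {a, b, c} \<and> e x y" if "x < 17" for x a b c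
  proof (rule ccontr)
    assume "\<not> ?thesis"
    then have "{y. y < 17 \<and> e x y} \<subseteq> {a, b, c}"
      by auto
    then have "card {y. y < 17 \<and> e x y} \<le> card {a, b, c}"
      by (rule card_mono[rotated]) simp
    also have "\<dots> \<le> 3"
      using card_insert_le_m1[of 3 "{b, c}" a] by (simp add: card_insert_if)
    finally show False
      using deg[OF that] by simp
  qed
  \<comment> \<open>\<open>l\<close> and \<open>t\<close> are kept folded so that the clauses below need no distribution of
    disjunctions over conjunctions.\<close>
  define l where "l x w k \<longleftrightarrow> e x k \<and> e w k" for x w k
  define t where "t a b \<longleftrightarrow> e 11 a \<and> e 11 b \<and> e a b" for a b
  \<comment> \<open>Excluding the known neighbours of a vertex beforehand keeps the number of freely
    chosen vertices small: one neighbour is known in \<open>degs\<close>, two in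
    \<open>degs'\<close>, none in \<open>degs''\<close>.\<close>
  have degs: "\<forall>(x, p)\<in>{(5, 1), (6, 1), (7, 2), (8, 2), (11, 3), (14, 4)}. \<forall>a\<in>{5..<17}. \<forall>b\<in>{Suc a..<17}.
      \<exists>y\<in>{0..<17}. y \<noteq> p \<and> y \<noteq> a \<and> y \<noteq> b \<and> e x y"
    using deg3[of _ 1] deg3[of _ 2] deg3[of _ 3] deg3[of _ 4] by auto
  have degs': "\<forall>(x, p, q)\<in>{(9, 3, 10), (10, 3, 9), (12, 4, 13), (13, 4, 12)}. \<forall>a\<in>{5..<17}.
      \<exists>y\<in>{0..<17}. y \<noteq> p \<and> y \<noteq> q \<and> y \<noteq> a \<and> e x y"
    using deg3[of _ 3] deg3[of _ 4] by auto
  have degs'': "\<forall>x\<in>{15, 16}. \<forall>a\<in>{5..<17}. \<forall>b\<in>{Suc a..<17}. \<forall>c\<in>{Suc b..<17}.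
      \<exists>y\<in>{0..<17}. y \<noteq> a \<and> y \<noteq> b \<and> y \<noteq> c \<and> e x y"
    using deg3 by auto
  have link': "\<exists>k\<in>{0..<17}. e x k \<and> e u k \<or> e x k \<and> e w k"
    if "x \<in> {1..<17}" "u \<in> {3, 4, 15, 16}" "w \<in> {3, 4, 15, 16}" "u \<noteq> w" "x \<noteq> u" "x \<noteq> w" for x u w
  proof -
    from link[OF _ _ that(2-6)] that(1) obtain k where "k < 17" "e x k \<and> (e u k \<or> e w k)"
      by auto
    then show ?thesis
      by (intro bexI[of _ k]) auto
  qed
  have links1: "\<forall>x\<in>{1..<17}. x \<noteq> 3 \<longrightarrow> x \<noteq> 4 \<longrightarrow> (\<exists>k\<in>{0..<17}. e x k \<and> (e 3 k \<or> e 4 k))"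
    using link'[of _ 3 4] by (simp add: conj_disj_distribL)
  have links2: "\<forall>x\<in>{1..<17}. \<forall>u\<in>{3, 4}. \<forall>w\<in>{15, 16}.
      x \<noteq> u \<longrightarrow> x \<noteq> w \<longrightarrow> (\<exists>k\<in>{0..<17}. e x k \<and> e u k \<or> l x w k)"
    unfolding l_def by (intro ballI impI link') auto
  have links3: "\<forall>x\<in>{1..<17}. x \<noteq> 15 \<longrightarrow> x \<noteq> 16 \<longrightarrow> (\<exists>k\<in>{0..<17}. l x 15 k \<or> l x 16 k)"
    unfolding l_def by (intro ballI impI link') auto
  have links4: "\<forall>x\<in>{1..<17}. \<forall>w\<in>{15, 16}. \<forall>k\<in>{0..<17}. (l x w k \<longrightarrow> e x k) \<and> (l x w k \<longrightarrow> e w k)"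
    by (simp add: l_def)
  note links = links1 links2 links3 links4
  have tris: "\<exists>a\<in>{5..<17}. \<exists>b\<in>{Suc a..<17}. t a b"
    "\<forall>a\<in>{5..<17}. \<forall>b\<in>{Suc a..<17}. t a b \<longrightarrow> e 11 a \<and> e 11 b \<and> e a b"
  proof -
    from tri obtain a b where ab: "a < b" "b < 17" "e 11 a" "e 11 b" "e a b"
      by blast
    \<comment> \<open>The only neighbour of 11 below 5 is 3. In a triangle with 3 and 11 the third
      vertex would be 9 or 10, and the edge 9-10 would then complete a 4-cycle.\<close>
    have "a \<ge> 5"
    proof (rule ccontr)
      assume "\<not> a \<ge> 5"
      then have "a \<in> {0, 1, 2, 3, 4}"
        by auto
      moreover have "e a 11"
        using ab(3) sym by blast
      ultimately have "a = 3"
        using N0[of 11] N1[of 11] N2[of 11] N4[of 11] by auto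
      with ab(1,2,5) have "b \<in> {9, 10, 11}"
        using N3[of b] by auto
      with ab(4) show False
        using siblings[of 3 10 11 9] siblings[of 3 9 11 10] star irr sym[of 9 10] by auto
    qed
    with ab show "\<exists>a\<in>{5..<17}. \<exists>b\<in>{Suc a..<17}. t a b"
      unfolding t_def by (intro bexI[of _ a] bexI[of _ b]) auto
  qed (simp add: t_def)
  note N' = N[unfolded sym[of 0] sym[of 1] sym[of 2] sym[of 3] sym[of 4] sym[of "Suc 0"]]
  \<comment> \<open>As an ordered rewrite rule \<open>sym\<close> picks one of \<open>e x y\<close> and \<open>e y x\<close>. It is applied twice
    because the simplifier does not renormalise the instances that unrolling a quantifier creates.\<close>
  note norm = sym irr N N' star star[simplified sym] star[unfolded One_nat_def] nonedges nonedges[simplified sym]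
  \<comment> \<open>\<open>set_upt\<close> would fold explicit lists back into intervals. With the
    lists kept, the bounded quantifiers below become finite conjunctions and disjunctions.\<close>
  note [simp del] = set_upt
  have upt: "[0..<17] = 0 # 1 # [2..<17]" "[1..<17] = 1 # [2..<17]" "[Suc 0..<17] = 1 # [2..<17]"
    by (simp_all add: upt_rec)
  note expand = atLeastLessThan_upt upt
  note pairs' = pairs[unfolded expand, simplified, simplified norm, simplified]
  note quads' = quads[unfolded expand, simplified, simplified norm, simplified]
  note degs_all = degs[unfolded expand, simplified, simplified norm, simplified norm, simplified]
    degs'[unfolded expand, simplified, simplified norm, simplified norm, simplified]
    degs''[unfolded expand, simplified, simplified norm, simplified norm, simplified]
  note links' = links[unfolded expand, simplified, simplified norm, simplified norm, simplified]
  note tris' = tris[unfolded expand, simplified, simplified norm, simplified norm, simplified]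
  show False
    using quads' pairs' degs_all links' tris' by sat
qed

section \<open>Counting triangles in regular graphs without 4-cycles\<close>

locale C4_free_regular_graph =
  fixes n k :: nat and E :: "nat \<Rightarrow> nat \<Rightarrow> bool"
  assumes sym: "E x y \<Longrightarrow> E y x"
    and irr: "\<not> E x x"
    and vertex: "E x y \<Longrightarrow> y < n"
    and deg: "x < n \<Longrightarrow> card {y. E x y} = k"
    and C4_free: "\<lbrakk>E x a; E x b; E y a; E y b; x \<noteq> y\<rbrakk> \<Longrightarrow> a = b"
begin

lemma finite_nbrs [simp]: "finite {y. E x y}"
  by (rule finite_subset[of _ "{..<n}"]) (auto dest: vertex)

lemma E_commute: "E x y \<longleftrightarrow> E y x"
  using sym by blast

definition triangles :: "nat set set" where
  "triangles = {t. t \<subseteq> {..<n} \<and> card t = 3 \<and> (\<forall>x\<in>t. \<forall>y\<in>t. x \<noteq> y \<longrightarrow> E x y)}"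

definition triangles_at :: "nat \<Rightarrow> nat set set" where
  "triangles_at x = {t \<in> triangles. x \<in> t}"

lemma finite_triangles [simp]: "finite triangles"
  unfolding triangles_def by (rule finite_subset[of _ "Pow {..<n}"]) auto

lemma finite_triangles_at [simp]: "finite (triangles_at x)"
  by (simp add: triangles_at_def)

lemma triangles_atI:
  assumes "E x y" "E x z" "E y z"
  shows "{x, y, z} \<in> triangles_at x"
proof -
  have "x < n" "y < n" "z < n"
    using assms sym vertex by blast+
  moreover have "x \<noteq> y" "x \<noteq> z" "y \<noteq> z"
    using assms irr by blast+
  ultimately show ?thesis
    using assms sym by (auto simp: triangles_at_def triangles_def)
qed

lemma triangles_atE:
  assumes "t \<in> triangles_at x"
  obtains y z where "t = {x, y, z}" "E x y" "E x z" "E y z" "y \<noteq> z"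
proof -
  from assms have t: "card t = 3" "x \<in> t" "\<forall>x\<in>t. \<forall>y\<in>t. x \<noteq> y \<longrightarrow> E x y"
    by (auto simp: triangles_at_def triangles_def)
  then have "card (t - {x}) = 2"
    by (simp add: card_Diff_singleton_if)
  then obtain y z where yz: "t - {x} = {y, z}" "y \<noteq> z"
    by (auto simp: card_2_iff)
  then have "t = {x, y, z}" "x \<noteq> y" "x \<noteq> z"
    using t(2) by auto
  with yz t(3) show thesis
    by (intro that[of y z]) auto
qed

text \<open>Double counting of the pairs of a triangle and one of its vertices; the factor 3 feeds
  the divisibility arguments.\<close>

lemma sum_card_triangles_at: "(\<Sum>x<n. card (triangles_at x)) = 3 * card triangles"
  unfolding triangles_at_def
proof (rule sum_multicount)
  show "\<forall>t\<in>triangles. card {x \<in> {..<n}. x \<in> t} = 3"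
  proof
    fix t
    assume "t \<in> triangles"
    moreover from this have "{x \<in> {..<n}. x \<in> t} = t"
      by (auto simp: triangles_def)
    ultimately show "card {x \<in> {..<n}. x \<in> t} = 3"
      by (simp add: triangles_def)
  qed
qed auto

text \<open>Different triangles at \<open>x\<close> meet only in \<open>x\<close>, so each uses up
  its own pair among the \<open>k\<close> neighbours of \<open>x\<close>.\<close>

lemma card_triangles_at_le:
  assumes "x < n"
  shows "2 * card (triangles_at x) \<le> k"
proof -
  have two: "card (t - {x}) = 2" if "t \<in> triangles_at x" for t
    using that by (auto simp: triangles_at_def triangles_def card_Diff_singleton_if)
  have "(\<Sum>t\<in>triangles_at x. card (t - {x})) = card (\<Union>t\<in>triangles_at x. t - {x})"
  proof (rule card_UN_disjoint[symmetric])
    show "\<forall>t\<in>triangles_at x. finite (t - {x})"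
      by (metis card.infinite two zero_neq_numeral)
    show "\<forall>s\<in>triangles_at x. \<forall>t\<in>triangles_at x. s \<noteq> t \<longrightarrow> (s - {x}) \<inter> (t - {x}) = {}"
    proof (intro ballI impI equals0I)
      fix s t y
      assume st: "s \<in> triangles_at x" "t \<in> triangles_at x" "s \<noteq> t" and y: "y \<in> (s - {x}) \<inter> (t - {x})"
      obtain a b where ab: "s = {x, a, b}" "E x a" "E x b" "E a b"
        using st(1) by (elim triangles_atE)
      obtain c d where cd: "t = {x, c, d}" "E x c" "E x d" "E c d"
        using st(2) by (elim triangles_atE)
      from y obtain z where z: "s = {x, y, z}" "E x z" "E y z"
        using ab sym by blast
      from y obtain w where w: "t = {x, y, w}" "E x w" "E y w"
        using cd sym by blast
      \<comment> \<open>\<open>x\<close> and the shared vertex \<open>y\<close> have the third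
        vertices \<open>z\<close> and \<open>w\<close> as common neighbours, which forces the two
        triangles to coincide.\<close>
      show False
        using C4_free[OF z(2) w(2) z(3) w(3)] y st(3) z(1) w(1) by blast
    qed
  qed simp
  also have "\<dots> \<le> card {y. E x y}"
    by (intro card_mono) (auto elim!: triangles_atE)
  finally show ?thesis
    using assms deg two by simp
qed

text \<open>The adjacency of the graph of \<open>\<Theta>\<close>.\<close>

definition far :: "nat \<Rightarrow> nat \<Rightarrow> bool" where
  "far x y \<longleftrightarrow> x < n \<and> y < n \<and> x \<noteq> y \<and> \<not> (\<exists>z. E x z \<and> E y z)"

text \<open>If every vertex is in a triangle, the 17 vertices can be listed around a vertex
  \<open>v\<close> in exactly one triangle, in the order that
  \<open>no_quartic_configuration\<close> expects, and the hypotheses transported along that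
  list.\<close>

lemma quartic_triangle_free_vertex:
  assumes k: "k = 4" and n: "n = 17"
    and far_C4_free: "\<And>x y a b. \<lbrakk>far x a; far x b; far y a; far y b; x \<noteq> y\<rbrakk> \<Longrightarrow> a = b"
  shows "\<exists>v<n. triangles_at v = {}"
proof (rule ccontr)
  assume "\<not> (\<exists>v<n. triangles_at v = {})"
  then have ex: "triangles_at x \<noteq> {}" if "x < n" for x
    using that by blast
  have deg4: "card {y. E x y} = 4" if "x < n" for x
    using deg[OF that] k by simp
  have "\<exists>v<n. card (triangles_at v) = 1"
  proof (rule ccontr)
    assume *: "\<not> (\<exists>v<n. card (triangles_at v) = 1)"
    \<comment> \<open>Otherwise every vertex is in exactly two triangles, and 3 would divide
      34.\<close>
    have "card (triangles_at v) = 2" if "v < n" for v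
      using card_triangles_at_le[OF that] ex[OF that] * that k
      by (metis Suc_1 card_0_eq finite_triangles_at le_SucE le_zero_eq mult_le_cancel1 mult_2_right numeral_Bit0 nat_mult_le_cancel_disj
          One_nat_def zero_less_numeral)
    then have "2 * n = 3 * card triangles"
      using sum_card_triangles_at by simp
    with n show False
      by presburger
  qed
  then obtain v t where v: "v < n" "triangles_at v = {t}"
    by (auto simp: card_1_singleton_iff)
  then have "t \<in> triangles_at v"
    by simp
  then obtain a b where ab: "t = {v, a, b}" "E v a" "E v b" "E a b" "a \<noteq> b"
    by (rule triangles_atE)
  have unique: "{y, z} = {a, b}" if "E v y" "E v z" "E y z" for y z
  proof -
    have "{v, y, z} = {v, a, b}"
      using triangles_atI[OF that] v ab by simp
    then show ?thesis
      using that ab irr by (metis insert_ident insertE singletonD)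
  qed
  have extend2: "\<exists>p q. p \<noteq> q \<and> {y. E x y} = {u, w, p, q} \<and> p \<notin> {u, w} \<and> q \<notin> {u, w}"
    if "E x u" "E x w" "u \<noteq> w" for x u w
  proof -
    have "x < n"
      using that sym vertex by blast
    then have "card ({y. E x y} - {u, w}) = 2"
      using that deg4 by (simp add: card_Diff_subset)
    then obtain p q where pq: "{y. E x y} - {u, w} = {p, q}" "p \<noteq> q"
      by (meson card_2_iff)
    then have "{y. E x y} = {u, w, p, q}"
      using that by blast
    then show ?thesis
      using pq by blast
  qed
  obtain c d where cd: "c \<noteq> d" "{y. E v y} = {a, b, c, d}" "c \<notin> {a, b}" "d \<notin> {a, b}"
    using extend2[OF ab(2,3,5)] by blast
  have Ev: "E v c" "E v d"
    using cd by auto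
  \<comment> \<open>The triangle chosen at \<open>x\<close> supplies the edge from \<open>p\<close>
    to \<open>q\<close>. It avoids \<open>v\<close>, since \<open>c\<close> and \<open>d\<close> are
    not in the unique triangle at \<open>v\<close>; \<open>r\<close> is the remaining
    neighbour.\<close>
  have extend3: "\<exists>p q r. E p q \<and> {y. E x y} = {v, p, q, r} \<and> distinct [v, p, q, r]"
    if "x \<in> {c, d}" for x
  proof -
    have x: "E v x" "x < n" "x \<notin> {a, b}"
      using that Ev cd vertex by auto
    then obtain s where s: "s \<in> triangles_at x"
      using ex by blast
    then obtain p q where pq: "s = {x, p, q}" "E x p" "E x q" "E p q" "p \<noteq> q"
      by (elim triangles_atE)
    have "p \<noteq> v" "q \<noteq> v"
      using pq unique[of x q] unique[of x p] x sym by (metis insert_iff)+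
    have "card ({y. E x y} - {v, p, q}) = 1"
      using sym[OF x(1)] pq \<open>p \<noteq> v\<close> \<open>q \<noteq> v\<close> deg4[OF x(2)] by (simp add: card_Diff_subset)
    then obtain r where r: "{y. E x y} - {v, p, q} = {r}"
      by (meson card_1_singletonE)
    then have "{y. E x y} = {v, p, q, r}"
      using sym[OF x(1)] pq by blast
    moreover have "distinct [v, p, q, r]"
      using r \<open>p \<noteq> v\<close> \<open>q \<noteq> v\<close> pq(5) by auto
    ultimately show ?thesis
      using pq(4) by blast
  qed
  obtain a1 a2 where a: "a1 \<noteq> a2" "{y. E a y} = {v, b, a1, a2}" "a1 \<notin> {v, b}" "a2 \<notin> {v, b}"
    using extend2[of a v b] ab sym irr by blast
  obtain b1 b2 where b: "b1 \<noteq> b2" "{y. E b y} = {v, a, b1, b2}" "b1 \<notin> {v, a}" "b2 \<notin> {v, a}"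
    using extend2[of b v a] ab sym irr by blast
  obtain c1 c2 c3 where c: "E c1 c2" "{y. E c y} = {v, c1, c2, c3}" "distinct [v, c1, c2, c3]"
    using extend3[of c] by blast
  obtain d1 d2 d3 where d: "E d1 d2" "{y. E d y} = {v, d1, d2, d3}" "distinct [v, d1, d2, d3]"
    using extend3[of d] by blast
  have Eabcd: "E a b" "E a a1" "E a a2" "E b b1" "E b b2" "E c c1" "E c c2" "E c c3" "E d d1" "E d d2" "E d d3"
    using ab a b c d by auto
  \<comment> \<open>The 15 vertices at distance at most 2 from \<open>v\<close>, at the positions
    prescribed by \<open>no_quartic_configuration\<close>; \<open>c1\<close>, \<open>c2\<close> and
    \<open>d1\<close>, \<open>d2\<close> are the adjacent pairs at 9, 10 and 12, 13.\<close>
  define L where "L = [v, a, b, c, d, a1, a2, b1, b2, c1, c2, c3, d1, d2, d3]"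
  have only: "y = v" if "E v x" "E v z" "x \<noteq> z" "E x y" "E z y" for x y z
    using C4_free[OF sym[OF that(4)] sym[OF that(5)] that(1,2)] that(3) by blast
  have "\<not> E v x" if "E z x" "E v z" "{z, x} \<noteq> {a, b}" for x z
    using unique[of z x] that by blast
  then have "\<forall>x\<in>{a1, a2, b1, b2, c1, c2, c3, d1, d2, d3}. \<not> E v x"
    using Eabcd ab(2,3) Ev a(3,4) b(3,4) cd(3,4) unfolding doubleton_eq_iff ball_simps by blast
  moreover have "\<forall>x\<in>{a, b, c, d}. E v x"
    using cd(2) by blast
  ultimately have "{a, b, c, d} \<inter> {a1, a2, b1, b2, c1, c2, c3, d1, d2, d3} = {}"
    by blast
  moreover have disjoint: "S \<inter> T = {}" if "x \<in> {a, b, c, d}" "z \<in> {a, b, c, d}" "x \<noteq> z"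
      "S \<subseteq> {y. E x y} - {v}" "T \<subseteq> {y. E z y} - {v}" for x z S T
    using only[of x z] that cd(2) by blast
  have sub: "{a1, a2} \<subseteq> {y. E a y} - {v}" "{b1, b2} \<subseteq> {y. E b y} - {v}"
      "{c1, c2, c3} \<subseteq> {y. E c y} - {v}" "{d1, d2, d3} \<subseteq> {y. E d y} - {v}"
    unfolding a(2) b(2) c(2) d(2) using a(3,4) b(3,4) c(3) d(3) by auto
  have "{a1, a2} \<inter> {b1, b2} = {}" "{a1, a2} \<inter> {c1, c2, c3} = {}" "{a1, a2} \<inter> {d1, d2, d3} = {}"
      "{b1, b2} \<inter> {c1, c2, c3} = {}" "{b1, b2} \<inter> {d1, d2, d3} = {}" "{c1, c2, c3} \<inter> {d1, d2, d3} = {}"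
    by (rule disjoint[OF _ _ _ sub(1,2)] disjoint[OF _ _ _ sub(1,3)] disjoint[OF _ _ _ sub(1,4)]
        disjoint[OF _ _ _ sub(2,3)] disjoint[OF _ _ _ sub(2,4)] disjoint[OF _ _ _ sub(3,4)];
        use ab(5) cd(1,3,4) in blast)+
  moreover have "v \<notin> {a, b, c, d}"
    using irr cd(2) by blast
  ultimately have "distinct L"
    using ab(5) cd(1,3,4) a(1,3,4) b(1,3,4) c(3) d(3) unfolding L_def by simp (metis)
  have "set L \<subseteq> {..<n}"
    using v vertex Ev ab Eabcd unfolding L_def by auto
  then have "card ({..<n} - set L) = 2"
    using \<open>distinct L\<close> n by (subst card_Diff_subset) (auto simp: distinct_card L_def)
  then obtain w w' where w: "{..<n} - set L = {w, w'}" "w \<noteq> w'"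
    by (auto simp: card_2_iff)
  define xs where "xs = L @ [w, w']"
  have xs: "distinct xs" "set xs = {..<n}"
    using w \<open>distinct L\<close> \<open>set L \<subseteq> {..<n}\<close> unfolding xs_def by auto
  have len: "length xs = 17"
    by (simp add: xs_def L_def)
  define e where "e i j \<longleftrightarrow> i < 17 \<and> j < 17 \<and> E (xs ! i) (xs ! j)" for i j
  have inj: "xs ! i = xs ! j \<longleftrightarrow> i = j" if "i < 17" "j < 17" for i j
    using that xs len nth_eq_iff_index_eq by metis
  have bij: "bij_betw ((!) xs) {..<17} {..<n}"
    using bij_betw_nth[OF xs(1), of "{..<17}" "{..<n}"] xs len by simp
  \<comment> \<open>These positions hold \<open>c\<close>, \<open>d\<close>, \<open>w\<close>,
    \<open>w'\<close>. The first two share no neighbour with \<open>v\<close> because its only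
    triangle avoids them; the last two are outside \<open>L\<close>, which contains all neighbours
    of \<open>a\<close>, \<open>b\<close>, \<open>c\<close> and \<open>d\<close>.\<close>
  have far_v: "far v (xs ! i)" if "i \<in> {3, 4, 15, 16}" for i
  proof -
    have "xs ! i \<in> {c, d, w, w'}"
      using that by (auto simp: xs_def L_def)
    moreover have "\<not> E x z" if "x \<in> {c, d}" "E v z" for x z
      using unique[of x z] that Ev cd(3,4) by blast
    moreover have "\<not> E x z" if "x \<in> {w, w'}" "E v z" for x z
    proof
      assume "E x z"
      have "z \<in> {a, b, c, d}"
        using that(2) cd(2) by blast
      then have "{y. E z y} \<subseteq> set L"
        using a(2) b(2) c(2) d(2) by (auto simp: L_def)
      with \<open>E x z\<close> w that(1) sym show False
        by blast
    qed
    moreover have "w \<in> {..<n} - set L" "w' \<in> {..<n} - set L"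
      unfolding w(1) by auto
    then have "{c, d, w, w'} \<subseteq> {..<n} - {v}"
      using \<open>distinct L\<close> \<open>set L \<subseteq> {..<n}\<close> by (auto simp: L_def)
    ultimately show ?thesis
      using v(1) unfolding far_def by blast
  qed
  show False
  proof (rule no_quartic_configuration[of e])
    show "e x y = e y x" for x y
      unfolding e_def using sym by blast
    show "\<not> e x x" for x
      unfolding e_def using irr by blast
    show False if "x < 17" "y < 17" "z < 17" "w < 17" "x \<noteq> z" "y \<noteq> w" "e x y" "e y z" "e z w" "e w x" for x y z w
      using that C4_free[of "xs ! x" "xs ! y" "xs ! w" "xs ! z"] inj sym unfolding e_def by blast
    show "card {y. y < 17 \<and> e x y} = 4" if "x < 17" for x
    proof -
      have "(!) xs ` {y. y < 17 \<and> e x y} = {y. E (xs ! x) y}"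
        using bij vertex that unfolding e_def bij_betw_def by (auto simp: image_iff)
      moreover have "inj_on ((!) xs) {y. y < 17 \<and> e x y}"
        using inj by (auto intro!: inj_onI)
      moreover have "xs ! x < n"
        using xs len that by (metis lessThan_iff nth_mem)
      ultimately show ?thesis
        using deg4 by (metis card_image)
    qed
    show "e 0 1" "e 0 2" "e 0 3" "e 0 4" "e 1 2" "e 1 5" "e 1 6" "e 2 7" "e 2 8"
      "e 3 9" "e 3 10" "e 3 11" "e 4 12" "e 4 13" "e 4 14" "e 9 10" "e 12 13"
      using ab Ev Eabcd c(1) d(1) unfolding e_def xs_def L_def by simp_all
    \<comment> \<open>Position 11 holds \<open>c3\<close>, which lies in a triangle like every
      vertex.\<close>
    show "\<exists>a<17. \<exists>b<17. a < b \<and> e 11 a \<and> e 11 b \<and> e a b"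
    proof -
      have "c3 < n"
        using Eabcd vertex by blast
      then obtain y z where yz: "E c3 y" "E c3 z" "E y z"
        using ex by (metis ex_in_conv triangles_atE)
      then obtain i j where ij: "i < 17" "j < 17" "y = xs ! i" "z = xs ! j"
        using vertex xs len by (metis in_set_conv_nth lessThan_iff)
      have "e 11 i" "e 11 j" "e i j" "e j i" "i \<noteq> j"
        using yz ij sym irr unfolding e_def by (auto simp: xs_def L_def)
      then show ?thesis
        using ij by (metis nat_neq_iff)
    qed
    \<comment> \<open>If the vertex at \<open>x\<close> were far from those at both \<open>u\<close>
      and \<open>w\<close>, it would be opposite to \<open>v\<close> in a 4-cycle of
      \<open>far\<close>.\<close>
    show "\<exists>k<17. e x k \<and> (e u k \<or> e w k)"
      if asm: "0 < x" "x < 17" "u \<in> {3, 4, 15, 16}" "w \<in> {3, 4, 15, 16}" "u \<noteq> w" "x \<noteq> u" "x \<noteq> w" for x u w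
    proof -
      have lt: "u < 17" "w < 17"
        using asm by auto
      have "xs ! 0 = v"
        by (simp add: xs_def L_def)
      then have "xs ! x \<noteq> v" "xs ! x < n" "xs ! u \<noteq> xs ! w"
        using asm inj[of x 0] inj[OF lt] xs len by (auto simp: set_conv_nth)
      then have "\<not> (far (xs ! x) (xs ! u) \<and> far (xs ! x) (xs ! w))"
        using far_C4_free[OF far_v[OF asm(3)] far_v[OF asm(4)]] by blast
      then obtain z where "E (xs ! x) z" "E (xs ! u) z \<or> E (xs ! w) z"
        using asm lt inj \<open>xs ! x < n\<close> far_v[OF asm(3)] far_v[OF asm(4)] unfolding far_def by metis
      moreover from this obtain k where "k < 17" "z = xs ! k"
        using vertex xs len by (metis in_set_conv_nth lessThan_iff)
      ultimately show ?thesis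
        using asm lt unfolding e_def by blast
    qed
  qed
qed

end

section \<open>Standard forms and renumbering\<close>

lemma K_mat_index:
  assumes "i < k" and "x < k^2 - k"
  shows "K_mat k $$ (i, x) = (if x div (k - 1) = i then 1 else 0)"
proof -
  have "k - 1 > 0"
    using assms by (cases "k \<le> 1") (auto simp: power2_eq_square le_Suc_eq)
  then have "x div (k - 1) = i" if "i * (k - 1) \<le> x" "x < (i + 1) * (k - 1)"
    using that by (intro div_nat_eqI) (auto simp: mult.commute)
  moreover have "(x div (k - 1)) * (k - 1) \<le> x" "x < (x div (k - 1) + 1) * (k - 1)"
    using dividend_less_div_times[OF \<open>k - 1 > 0\<close>, of x] by (simp_all del: diff_mult_distrib)
  ultimately show ?thesis
    using assms by (auto simp: K_mat_def)
qed

lemma std_form_carrier: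
  assumes "P \<in> carrier_mat (k^2 - k) (k^2 - k)"
  shows "std_form k P \<in> carrier_mat (k^2 + 1) (k^2 + 1)"
proof -
  have "1 + k + (k^2 - k) = k^2 + 1"
    by (cases k) (auto simp: power2_eq_square)
  then show ?thesis
    using assms by (auto simp: std_form_def)
qed

text \<open>Vertex 0 is the root, 1 to \<open>k\<close> are its neighbours, and the vertices from
  \<open>k + 1\<close> on come in \<open>k\<close> groups of \<open>k - 1\<close>, one per
  neighbour; hence the offsets. The flat case distinction lets renumberings be checked entry by
  entry.\<close>

lemma std_form_index:
  assumes "P \<in> carrier_mat (k^2 - k) (k^2 - k)" and "i < k^2 + 1" and "j < k^2 + 1"
  shows "std_form k P $$ (i, j) =
    (if i = 0 then if 0 < j \<and> j \<le> k then 1 else 0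
     else if i \<le> k then
       if j = 0 then 1 else if j \<le> k then 0 else if (j - (k + 1)) div (k - 1) = i - 1 then 1 else 0
     else if j = 0 then 0 else if j \<le> k then if (i - (k + 1)) div (k - 1) = j - 1 then 1 else 0
     else P $$ (i - (k + 1), j - (k + 1)))"
proof -
  have le: "k \<le> k^2"
    by (simp add: power2_nat_le_imp_le power2_eq_square)
  define U :: "int mat" where "U = four_block_mat (0\<^sub>m 1 1) (ones_mat 1 k) (transpose_mat (ones_mat 1 k)) (0\<^sub>m k k)"
  define V where "V = 0\<^sub>m 1 (k^2 - k) @\<^sub>r K_mat k"
  have K: "dim_row (K_mat k) = k" "dim_col (K_mat k) = k^2 - k"
    by (simp_all add: K_mat_def)
  have dim: "dim_row U = k + 1" "dim_col U = k + 1" "dim_row V = k + 1" "dim_col V = k^2 - k"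
    by (simp_all add: U_def V_def append_rows_def K)
  have U: "U $$ (a, b) = (if a = 0 then if b = 0 then 0 else 1 else if b = 0 then 1 else 0)" if "a < k + 1" "b < k + 1" for a b
    using that by (auto simp: U_def)
  have V: "V $$ (a, b) = (if a = 0 then 0 else if b div (k - 1) = a - 1 then 1 else 0)" if "a < k + 1" "b < k^2 - k" for a b
    using that by (auto simp: V_def append_rows_def K K_mat_index)
  have lt: "l - (k + 1) < k^2 - k" if "l < k^2 + 1" "\<not> l < k + 1" for l
    using that by auto
  have dimP: "dim_row P = k^2 - k" "dim_col P = k^2 - k"
    using assms(1) by auto
  have "std_form k P $$ (i, j) =
    (if i < k + 1 then if j < k + 1 then U $$ (i, j) else V $$ (i, j - (k + 1))
     else if j < k + 1 then transpose_mat V $$ (i - (k + 1), j) else P $$ (i - (k + 1), j - (k + 1)))"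
    unfolding std_form_def U_def[symmetric] V_def[symmetric]
    using assms(2,3) le dimP dim by (subst index_mat_four_block) auto
  moreover have "transpose_mat V $$ (i - (k + 1), j) = V $$ (j, i - (k + 1))" if "j < k + 1" "\<not> i < k + 1"
    using that lt[OF assms(2)] dim by (intro index_transpose_mat) auto
  ultimately show ?thesis
    using U V lt[OF assms(2)] lt[OF assms(3)] by (cases "i < k + 1"; cases "j < k + 1"; simp flip: less_Suc_eq_le)
qed

section \<open>Permutation matrices and p-equivalence\<close>

text \<open>Nonnegativity suffices, since an entry is then bounded by its row sum 1. Unlike having
  only entries 0 and 1, it is visibly preserved by products.\<close>

lemma permutation_mat_iff:
  "permutation_mat r S \<longleftrightarrow> S \<in> carrier_mat r r \<and> (\<forall>i<r. \<forall>j<r. 0 \<le> S $$ (i, j)) \<and> has_const_sums S 1"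
proof -
  have "S $$ (i, j) = 0 \<or> S $$ (i, j) = 1"
    if S: "S \<in> carrier_mat r r" "\<forall>i<r. \<forall>j<r. 0 \<le> S $$ (i, j)" "has_const_sums S 1" and ij: "i < r" "j < r" for i j
  proof -
    have "S $$ (i, j) \<le> (\<Sum>l<r. S $$ (i, l))"
      using S ij by (intro member_le_sum) auto
    also have "\<dots> = 1"
      using S ij by (auto simp: has_const_sums_def)
    finally have "S $$ (i, j) \<le> 1" .
    moreover have "0 \<le> S $$ (i, j)"
      using S ij by blast
    ultimately show ?thesis
      by linarith
  qed
  moreover have "0 \<le> S $$ (i, j)" if "S \<in> carrier_mat r r" "zero_one_mat S" "i < r" "j < r" for i j
    using that by (force simp: zero_one_mat_iff[OF that(1)])
  ultimately show ?thesis
    unfolding permutation_mat_def using zero_one_mat_iff[of S r r] by blast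
qed

lemma permutation_mat_mult:
  assumes "permutation_mat r S" and "permutation_mat r T"
  shows "permutation_mat r (S * T)"
proof -
  have S: "S \<in> carrier_mat r r" "\<forall>i<r. \<forall>j<r. 0 \<le> S $$ (i, j)" "has_const_sums S 1"
    and T: "T \<in> carrier_mat r r" "\<forall>i<r. \<forall>j<r. 0 \<le> T $$ (i, j)" "has_const_sums T 1"
    using assms by (auto simp: permutation_mat_iff)
  have idx: "(S * T) $$ (i, j) = (\<Sum>l<r. S $$ (i, l) * T $$ (l, j))" if "i < r" "j < r" for i j
    using S T that by (simp add: scalar_prod_def lessThan_atLeast0)
  have row: "(\<Sum>j<r. (S * T) $$ (i, j)) = 1" if i: "i < r" for i
  proof -
    have "(\<Sum>j<r. (S * T) $$ (i, j)) = (\<Sum>l<r. S $$ (i, l) * (\<Sum>j<r. T $$ (l, j)))"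
      using i by (simp add: idx sum_distrib_left) (rule sum.swap)
    also have "\<dots> = (\<Sum>l<r. S $$ (i, l))"
      using T by (intro sum.cong) (auto simp: has_const_sums_def)
    finally show ?thesis
      using S i by (simp add: has_const_sums_def)
  qed
  have col: "(\<Sum>i<r. (S * T) $$ (i, j)) = 1" if j: "j < r" for j
  proof -
    have "(\<Sum>i<r. (S * T) $$ (i, j)) = (\<Sum>l<r. (\<Sum>i<r. S $$ (i, l)) * T $$ (l, j))"
      using j by (simp add: idx sum_distrib_right) (rule sum.swap)
    also have "\<dots> = (\<Sum>l<r. T $$ (l, j))"
      using S by (intro sum.cong) (auto simp: has_const_sums_def)
    finally show ?thesis
      using T j by (simp add: has_const_sums_def)
  qed
  show ?thesis
    unfolding permutation_mat_iff has_const_sums_def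
    using S T row col idx by (auto intro!: sum_nonneg)
qed

lemma p_equivalent_trans:
  assumes AB: "p_equivalent A B" and BC: "p_equivalent B C"
  shows "p_equivalent A C"
proof -
  obtain S T where S: "permutation_mat (dim_row A) S" "similar_mat_wit B A T S"
    using AB by (auto simp: p_equivalent_def)
  obtain S' T' where S': "permutation_mat (dim_row B) S'" "similar_mat_wit C B T' S'"
    using BC by (auto simp: p_equivalent_def)
  have "dim_row B = dim_row A"
    using similar_mat_witD(5)[OF refl S(2)] by simp
  then have "permutation_mat (dim_row A) (S * S')"
    using S(1) S'(1) permutation_mat_mult by simp
  then show ?thesis
    using similar_mat_wit_trans[OF S'(2) S(2)] unfolding p_equivalent_def by blast
qed

text \<open>The matrix with ones at the positions \<open>(f y, y)\<close> has its transpose as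
  inverse, and conjugation by it renumbers rows and columns by \<open>f\<close>. This reduces
  p-equivalences to bijections of indices.\<close>

lemma p_equivalent_reindex:
  assumes f: "bij_betw f {..<n} {..<n}" and A: "A \<in> carrier_mat n n" and M: "M \<in> carrier_mat n n"
    and eq: "\<And>i j. i < n \<Longrightarrow> j < n \<Longrightarrow> M $$ (i, j) = A $$ (f i, f j)"
  shows "p_equivalent A M"
proof -
  define S :: "int mat" where "S = mat n n (\<lambda>(x, y). if x = f y then 1 else 0)"
  have S: "S \<in> carrier_mat n n" and idx: "x < n \<Longrightarrow> y < n \<Longrightarrow> S $$ (x, y) = (if x = f y then 1 else 0)" for x y
    by (simp_all add: S_def)
  have lt: "f x < n" if "x < n" for x
    using f that by (auto simp: bij_betw_def)
  have inj: "f x = f y \<longleftrightarrow> x = y" if "x < n" "y < n" for x y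
    using f that by (auto simp: bij_betw_def inj_on_def)
  have pick: "(\<Sum>x<n. h x * (if x = y then 1 else 0)) = (h y :: int)"
      "(\<Sum>x<n. (if x = y then 1 else 0) * h x) = (h y :: int)" if "y < n" for h y
    using that by (simp_all add: if_distrib[of "\<lambda>z. z * _"] if_distrib[of "\<lambda>z. _ * z"] cong: if_cong)
  have TS: "transpose_mat S * S = 1\<^sub>m n"
    using S lt inj by (intro eq_matI) (auto simp: scalar_prod_def idx pick lessThan_atLeast0[symmetric])
  have ST: "S * transpose_mat S = 1\<^sub>m n"
  proof (rule eq_matI)
    fix x y
    assume "x < dim_row (1\<^sub>m n :: int mat)" "y < dim_col (1\<^sub>m n :: int mat)"
    then have "x \<in> f ` {..<n}" "y \<in> f ` {..<n}"
      using f by (auto simp: bij_betw_def)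
    then obtain a b where ab: "a < n" "b < n" "x = f a" "y = f b"
      by blast
    have "(S * transpose_mat S) $$ (x, y) = (\<Sum>z<n. (if x = f z then 1 else 0) * (if y = f z then 1 else 0))"
      using S ab lt by (auto simp: scalar_prod_def idx lessThan_atLeast0 intro!: sum.cong)
    also have "\<dots> = (\<Sum>z<n. (if z = a then 1 else 0) * (if z = b then 1 else 0))"
      using ab inj by (intro sum.cong) auto
    finally show "(S * transpose_mat S) $$ (x, y) = 1\<^sub>m n $$ (x, y)"
      using ab inj lt by (simp add: pick)
  qed (use S in auto)
  have "(transpose_mat S * A * S) $$ (i, j) = A $$ (f i, f j)" if "i < n" "j < n" for i j
    using S A lt that by (simp add: scalar_prod_def idx pick lessThan_atLeast0[symmetric])
  then have "M = transpose_mat S * A * S"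
    using M S eq by (intro eq_matI) auto
  then have "similar_mat_wit M A (transpose_mat S) S"
    using M A S TS ST by (auto simp: similar_mat_wit_def Let_def)
  moreover have "permutation_mat n S"
  proof -
    have "(\<Sum>x<n. S $$ (x, y)) = 1" if "y < n" for y
      using that lt by (simp add: idx)
    moreover have "(\<Sum>y<n. S $$ (x, y)) = 1" if x: "x < n" for x
    proof -
      obtain z where z: "z < n" "x = f z"
        using f x by (auto simp: bij_betw_def image_iff)
      have "(\<Sum>y<n. S $$ (x, y)) = (\<Sum>y<n. if z = y then 1 else 0)"
        by (intro sum.cong) (use idx x z inj in auto)
      then show ?thesis
        using z by simp
    qed
    ultimately show ?thesis
      using S by (auto simp: permutation_mat_iff has_const_sums_def idx)
  qed
  ultimately show ?thesis
    using A by (auto simp: p_equivalent_def)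
qed

section \<open>Positions inside blocks, and blocks that are permutation matrices\<close>

lemma square_minus_self: "(k::nat)^2 - k = k * (k - 1)"
  by (simp add: power2_eq_square diff_mult_distrib2)

lemma block_position_less:
  fixes k :: nat
  assumes "i < k" and "a < k - 1"
  shows "i * (k - 1) + a < k^2 - k"
proof -
  have "i * (k - 1) + a < (i + 1) * (k - 1)"
    using assms by simp
  also have "\<dots> \<le> k * (k - 1)"
    using assms by (intro mult_le_mono1) simp
  finally show ?thesis
    by (simp add: square_minus_self)
qed

lemma sum_block_positions:
  fixes k :: nat
  shows "(\<Sum>x<k^2 - k. h x) = (\<Sum>j<k. \<Sum>b<k - 1. h (j * (k - 1) + b))"
proof -
  have "(\<Sum>x<k^2 - k. h x) = (\<Sum>j<k. sum h {j * (k - 1)..<j * (k - 1) + (k - 1)})"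
    unfolding square_minus_self by (rule sum.nat_group[symmetric])
  also have "\<dots> = (\<Sum>j<k. \<Sum>b<k - 1. h (j * (k - 1) + b))"
  proof (rule sum.cong[OF refl])
    fix j
    show "sum h {j * (k - 1)..<j * (k - 1) + (k - 1)} = (\<Sum>b<k - 1. h (j * (k - 1) + b))"
      using sum.shift_bounds_nat_ivl[of h 0 "j * (k - 1)" "k - 1"] by (simp add: lessThan_atLeast0 add.commute)
  qed
  finally show ?thesis .
qed

lemma block_carrier [simp]: "block k P i j \<in> carrier_mat (k - 1) (k - 1)"
  by (simp add: block_def)

lemma block_index [simp]:
  "a < k - 1 \<Longrightarrow> b < k - 1 \<Longrightarrow> block k P i j $$ (a, b) = P $$ (i * (k - 1) + a, j * (k - 1) + b)"
  by (simp add: block_def)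

lemma sum_zero_one:
  fixes h :: "nat \<Rightarrow> int"
  assumes "\<And>x. x < m \<Longrightarrow> h x = 0 \<or> h x = 1"
  shows "(\<Sum>x<m. h x) = int (card {x. x < m \<and> h x = 1})"
proof -
  have "(\<Sum>x<m. h x) = (\<Sum>x<m. if h x = 1 then 1 else 0)"
    using assms by (intro sum.cong) auto
  also have "\<dots> = int (card ({..<m} \<inter> {x. h x = 1}))"
    by (simp add: sum.If_cases)
  also have "{..<m} \<inter> {x. h x = 1} = {x. x < m \<and> h x = 1}"
    by auto
  finally show ?thesis .
qed

lemma partial_permutation_mat_sums_le:
  assumes B: "B \<in> carrier_mat m m" "partial_permutation_mat B" and a: "a < m"
  shows "(\<Sum>b<m. B $$ (a, b)) \<le> 1" and "(\<Sum>b<m. B $$ (b, a)) \<le> 1"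
proof -
  have zero_one: "B $$ (x, y) = 0 \<or> B $$ (x, y) = 1" if "x < m" "y < m" for x y
    using B that zero_one_mat_iff unfolding partial_permutation_mat_def by blast
  have "card {b. b < m \<and> B $$ (a, b) = 1} \<le> 1" "card {b. b < m \<and> B $$ (b, a) = 1} \<le> 1"
    using B a by (auto simp: partial_permutation_mat_def)
  then show "(\<Sum>b<m. B $$ (a, b)) \<le> 1" "(\<Sum>b<m. B $$ (b, a)) \<le> 1"
    using zero_one a by (simp_all add: sum_zero_one)
qed

text \<open>The defects \<open>1 - h x\<close> are nonnegative and add up to 0.\<close>

lemma sum_one_eq:
  fixes h :: "nat \<Rightarrow> int"
  assumes "\<And>x. x \<in> S \<Longrightarrow> h x \<le> 1" and "sum h S = int (card S)" and "finite S" and "x \<in> S"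
  shows "h x = 1"
proof -
  have "(\<Sum>x\<in>S. 1 - h x) = 0"
    using assms(2) by (simp add: sum_subtractf)
  then have "\<forall>x\<in>S. 1 - h x = 0"
    using assms(1,3) by (subst (asm) sum_nonneg_eq_0_iff) auto
  then show ?thesis
    using assms(4) by auto
qed

text \<open>Full rows give \<open>m\<close> ones altogether; \<open>m\<close> columns with at most
  one each must then have exactly one each.\<close>

lemma partial_permutation_mat_imp_permutation_mat:
  assumes B: "B \<in> carrier_mat m m" "partial_permutation_mat B" and row: "\<And>a. a < m \<Longrightarrow> (\<Sum>b<m. B $$ (a, b)) = 1"
  shows "permutation_mat m B"
proof -
  have "(\<Sum>b<m. \<Sum>a<m. B $$ (a, b)) = int (card {..<m})"
    using row by (subst sum.swap) simp
  then have "(\<Sum>a<m. B $$ (a, b)) = 1" if "b < m" for b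
    using sum_one_eq[of "{..<m}" "\<lambda>b. \<Sum>a<m. B $$ (a, b)" b] partial_permutation_mat_sums_le(2)[OF B] that by simp
  then show ?thesis
    using B row by (auto simp: permutation_mat_def has_const_sums_def partial_permutation_mat_def)
qed

lemma permutation_mat_transpose: "permutation_mat m B \<Longrightarrow> permutation_mat m (transpose_mat B)"
  by (auto simp: permutation_mat_iff has_const_sums_def)

lemma std_param_symmetric:
  assumes "std_param k P" "x < k^2 - k" "y < k^2 - k"
  shows "P $$ (x, y) = P $$ (y, x)"
proof -
  have "transpose_mat P $$ (x, y) = P $$ (y, x)"
    using assms by (intro index_transpose_mat(1)) (auto simp: std_param_def)
  then show ?thesis
    using assms by (simp add: std_param_def)
qed

lemma block_transpose:
  assumes P: "std_param k P" and ij: "i < k" "j < k"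
  shows "transpose_mat (block k P i j) = block k P j i"
proof (rule eq_matI)
  fix a b
  assume "a < dim_row (block k P j i)" "b < dim_col (block k P j i)"
  then have "a < k - 1" "b < k - 1"
    by (simp_all add: block_def)
  then show "transpose_mat (block k P i j) $$ (a, b) = block k P j i $$ (a, b)"
    using std_param_symmetric[OF P block_position_less block_position_less] ij by (simp add: block_def)
qed (simp_all add: block_def)

text \<open>The one in row \<open>a\<close> sits in column \<open>s a\<close>, and \<open>s\<close>
  is injective because each column has a single one. In this form, reordering the columns by
  \<open>s\<close> produces the identity, which is how blocks are normalised later.\<close>

lemma permutation_mat_bij:
  assumes B: "permutation_mat m B"
  shows "\<exists>s. bij_betw s {..<m} {..<m} \<and> (\<forall>a<m. \<forall>b<m. B $$ (a, s b) = (if a = b then 1 else 0))"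
proof -
  have zero_one: "B $$ (a, b) = 0 \<or> B $$ (a, b) = 1" if "a < m" "b < m" for a b
    using B that zero_one_mat_iff unfolding permutation_mat_def by blast
  have sums: "(\<Sum>b<m. B $$ (a, b)) = 1" "(\<Sum>b<m. B $$ (b, a)) = 1" if "a < m" for a
    using B that by (auto simp: permutation_mat_def has_const_sums_def)
  have row: "card {b. b < m \<and> B $$ (a, b) = 1} = 1" and col: "card {b. b < m \<and> B $$ (b, a) = 1} = 1" if "a < m" for a
    using sums[OF that] zero_one that by (auto simp: sum_zero_one)
  have "\<forall>a\<in>{..<m}. \<exists>b. {b'. b' < m \<and> B $$ (b', a) = 1} = {b}"
    using col by (auto simp: card_1_singleton_iff)
  then obtain r where r: "\<And>a. a < m \<Longrightarrow> {b'. b' < m \<and> B $$ (b', a) = 1} = {r a}"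
    by (metis lessThan_iff)
  have "\<forall>a\<in>{..<m}. \<exists>b. {b'. b' < m \<and> B $$ (a, b') = 1} = {b}"
    using row by (auto simp: card_1_singleton_iff)
  then obtain s where s: "\<And>a. a < m \<Longrightarrow> {b'. b' < m \<and> B $$ (a, b') = 1} = {s a}"
    by (metis lessThan_iff)
  have one: "s a < m" "B $$ (a, s a) = 1" if "a < m" for a
    using s[OF that] by blast+
  have inj: "a = a'" if "a < m" "a' < m" "B $$ (a, s a') = 1" for a a'
  proof -
    have "{b. b < m \<and> B $$ (b, s a') = 1} = {r (s a')}"
      using r one(1) that(2) by blast
    moreover have "a \<in> {b. b < m \<and> B $$ (b, s a') = 1}" "a' \<in> {b. b < m \<and> B $$ (b, s a') = 1}"
      using that one(2) by auto
    ultimately show ?thesis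
      by simp
  qed
  have "inj_on s {..<m}"
  proof (rule inj_onI)
    fix x y
    assume "x \<in> {..<m}" "y \<in> {..<m}" "s x = s y"
    then have "x < m" "y < m" "B $$ (x, s y) = 1"
      using one(2)[of x] by auto
    then show "x = y"
      by (rule inj)
  qed
  moreover have "s ` {..<m} \<subseteq> {..<m}"
    using one by auto
  ultimately have "bij_betw s {..<m} {..<m}"
    by (simp add: bij_betw_def endo_inj_surj)
  moreover have "B $$ (a, s b) = (if a = b then 1 else 0)" if "a < m" "b < m" for a b
    using inj[OF that] one[OF that(2)] zero_one[OF that(1) one(1)[OF that(2)]] by auto
  ultimately show ?thesis
    by blast
qed

section \<open>Zero blocks and the normalisation of the first block row\<close>

context
  fixes k :: nat and P :: "int mat"
  assumes param: "std_param k P"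
    and blocks: "\<forall>i<k. \<forall>j<k. partial_permutation_mat (block k P i j)"
begin

text \<open>A row of \<open>P\<close> contains \<open>k - 1\<close> ones. None of them is in the
  zero block, and the other \<open>k - 1\<close> blocks hold at most one each, hence exactly
  one.\<close>

lemma zero_block_row:
  assumes i: "i < k" and j: "j < k" and zero: "block k P i j = 0\<^sub>m (k - 1) (k - 1)"
    and l: "l < k" "l \<noteq> j"
  shows "permutation_mat (k - 1) (block k P i l)"
proof (rule partial_permutation_mat_imp_permutation_mat)
  fix a
  assume a: "a < k - 1"
  define r where "r l = (\<Sum>b<k - 1. block k P i l $$ (a, b))" for l
  have "(\<Sum>x<k^2 - k. P $$ (i * (k - 1) + a, x)) = int k - 1"
    using param block_position_less[OF i a] by (auto simp: std_param_def has_const_sums_def)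
  then have "(\<Sum>l<k. r l) = int k - 1"
    using a by (simp add: sum_block_positions r_def)
  moreover have "r j = 0"
    using zero a by (simp add: r_def del: block_index)
  ultimately have "sum r ({..<k} - {j}) = int (card ({..<k} - {j}))"
    using j by (simp add: sum_diff1 of_nat_diff)
  moreover have "r l \<le> 1" if "l < k" for l
    using partial_permutation_mat_sums_le(1)[OF block_carrier _ a] blocks i that unfolding r_def by blast
  ultimately show "(\<Sum>b<k - 1. block k P i l $$ (a, b)) = 1"
    using sum_one_eq[of "{..<k} - {j}" r l] l unfolding r_def by auto
qed (use blocks i l block_carrier in blast)+

lemma zero_block_column:
  assumes "i < k" and "j < k" and "block k P i j = 0\<^sub>m (k - 1) (k - 1)" and "l < k" and "l \<noteq> i"
  shows "permutation_mat (k - 1) (block k P l j)"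
proof -
  have "block k P j i = 0\<^sub>m (k - 1) (k - 1)"
    using block_transpose[OF param assms(1,2)] assms(3) by simp
  then have "permutation_mat (k - 1) (block k P j l)"
    using assms zero_block_row by blast
  then show ?thesis
    using permutation_mat_transpose block_transpose[OF param assms(2,4)] by metis
qed

text \<open>Interchanging the blocks 0 and \<open>i\<close> moves the zero block into the corner.
  The positions inside every block other than 0 are then reordered so that the permutation matrices
  of block row \<open>i\<close> become identities.\<close>

lemma normalise_zero_diagonal_block:
  assumes i: "i < k" and zero: "block k P i i = 0\<^sub>m (k - 1) (k - 1)"
  shows "\<exists>P'. std_param k P' \<and> p_equivalent (std_form k P) (std_form k P') \<and>
           block k P' 0 0 = 0\<^sub>m (k - 1) (k - 1) \<and>
           (\<forall>i \<in> {1..<k}. block k P' 0 i = 1\<^sub>m (k - 1) \<and> block k P' i 0 = 1\<^sub>m (k - 1))"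
proof -
  define m where "m = k - 1"
  define K where "K = k^2 - k"
  define \<pi> where "\<pi> j = (if j = 0 then i else if j = i then 0 else j)" for j
  have \<pi>: "\<pi> j < k" "\<pi> (\<pi> j) = j" if "j < k" for j
    using that i by (auto simp: \<pi>_def)
  \<comment> \<open>Block 0 keeps its order: its positions index the rows of the first block row,
    where only the columns are to be permuted.\<close>
  have "\<exists>s. bij_betw s {..<m} {..<m} \<and>
      (if j = 0 then s = id else \<forall>a<m. \<forall>b<m. block k P i (\<pi> j) $$ (a, s b) = (if a = b then 1 else 0))" if "j < k" for j
  proof (cases "j = 0")
    case True
    then show ?thesis
      by simp
  next
    case False
    then have "\<pi> j \<noteq> i"
      by (simp add: \<pi>_def)
    from permutation_mat_bij[OF zero_block_row[OF i i zero \<pi>(1)[OF that] this]] False show ?thesis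
      unfolding m_def by simp
  qed
  then have "\<forall>j\<in>{..<k}. \<exists>s. bij_betw s {..<m} {..<m} \<and>
      (if j = 0 then s = id else \<forall>a<m. \<forall>b<m. block k P i (\<pi> j) $$ (a, s b) = (if a = b then 1 else 0))"
    by blast
  then have "\<exists>s. \<forall>j\<in>{..<k}. bij_betw (s j) {..<m} {..<m} \<and>
      (if j = 0 then s j = id else \<forall>a<m. \<forall>b<m. block k P i (\<pi> j) $$ (a, s j b) = (if a = b then 1 else 0))"
    by (rule bchoice)
  then obtain s where s_spec: "\<forall>j\<in>{..<k}. bij_betw (s j) {..<m} {..<m} \<and>
      (if j = 0 then s j = id else \<forall>a<m. \<forall>b<m. block k P i (\<pi> j) $$ (a, s j b) = (if a = b then 1 else 0))"
    by blast
  have s: "bij_betw (s j) {..<m} {..<m}" if "j < k" for j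
    using s_spec that by blast
  have sP: "block k P i (\<pi> j) $$ (a, s j b) = (if a = b then 1 else 0)" if "j < k" "j \<noteq> 0" "a < m" "b < m" for j a b
    using s_spec that by auto
  have s0: "s 0 = id"
    using s_spec i by auto
  have s_lt: "s j a < m" if "j < k" "a < m" for j a
    using bij_betwE[OF s[OF that(1)]] that(2) by blast
  \<comment> \<open>\<open>g\<close> sends a new position to the old one that it takes its entries
    from.\<close>
  define g where "g x = \<pi> (x div m) * m + s (x div m) (x mod m)" for x
  have g: "g (j * m + a) = \<pi> j * m + s j a" if "a < m" for j a
    using that by (simp add: g_def)
  have pos: "m > 0" and div_lt: "x div m < k" and mod_lt: "x mod m < m" if "x < K" for x
  proof -
    have "x < k * m"
      using that by (simp add: K_def m_def square_minus_self)
    then show "m > 0"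
      by (cases "m = 0") auto
    then show "x mod m < m"
      by simp
    show "x div m < k"
      using \<open>x < k * m\<close> by (simp add: less_mult_imp_div_less)
  qed
  have g_div: "g x div m = \<pi> (x div m)" and g_mod: "g x mod m = s (x div m) (x mod m)" and g_lt: "g x < K" if "x < K" for x
    using s_lt[OF div_lt mod_lt, OF that that] block_position_less[OF \<pi>(1)[OF div_lt[OF that]]]
    by (auto simp: g_def m_def K_def)
  have g_bij: "bij_betw g {..<K} {..<K}"
  proof -
    have "inj_on g {..<K}"
    proof (rule inj_onI)
      fix x y
      assume xy: "x \<in> {..<K}" "y \<in> {..<K}" "g x = g y"
      then have "\<pi> (x div m) = \<pi> (y div m)" "s (x div m) (x mod m) = s (y div m) (y mod m)"
        using g_div g_mod by (metis lessThan_iff)+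
      then have "x div m = y div m"
        using \<pi>(2) div_lt xy by (metis lessThan_iff)
      moreover from this have "x mod m = y mod m"
        using \<open>s (x div m) (x mod m) = _\<close> s[OF div_lt[of x]] mod_lt xy
        by (metis bij_betw_imp_inj_on inj_onD lessThan_iff)
      ultimately show "x = y"
        by (metis div_mult_mod_eq)
    qed
    moreover have "g ` {..<K} \<subseteq> {..<K}"
      using g_lt by auto
    ultimately show ?thesis
      by (simp add: bij_betw_def endo_inj_surj)
  qed
  define P' where "P' = mat K K (\<lambda>(x, y). P $$ (g x, g y))"
  have P: "P \<in> carrier_mat K K" "zero_one_mat P" "has_const_sums P (int k - 1)"
    and P': "P' \<in> carrier_mat K K"
    using param by (simp_all add: std_param_def K_def P'_def)
  have P'_idx: "P' $$ (x, y) = P $$ (g x, g y)" if "x < K" "y < K" for x y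
    using that by (simp add: P'_def)
  have P'_param: "std_param k P'"
  proof -
    have "transpose_mat P' = P'"
      using P' std_param_symmetric[OF param] g_lt by (intro eq_matI) (auto simp: P'_idx K_def)
    moreover have "zero_one_mat P'"
      using P P' g_lt by (auto simp: zero_one_mat_iff[of _ K K] P'_idx)
    moreover have "(\<Sum>y<K. P $$ (g x, g y)) = int k - 1" "(\<Sum>y<K. P $$ (g y, g x)) = int k - 1" if "x < K" for x
      using sum.reindex_bij_betw[OF g_bij, of "\<lambda>y. P $$ (g x, y)"]
        sum.reindex_bij_betw[OF g_bij, of "\<lambda>y. P $$ (y, g x)"] P g_lt[OF that]
      by (auto simp: has_const_sums_def)
    then have "has_const_sums P' (int k - 1)"
      using P' by (auto simp: has_const_sums_def P'_idx)
    ultimately show ?thesis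
      using P' by (simp add: std_param_def K_def)
  qed
  \<comment> \<open>\<open>f\<close> extends \<open>g\<close> to all vertices: the root stays fixed
    and the neighbours of the root follow their groups by \<open>\<pi>\<close>, so the part of the
    standard form outside \<open>P\<close> is unchanged.\<close>
  define f where "f x = (if x = 0 then 0 else if x \<le> k then \<pi> (x - 1) + 1 else g (x - (k + 1)) + (k + 1))" for x
  have n: "k^2 + 1 = K + (k + 1)"
    using power2_nat_le_imp_le[of k "k^2"] by (simp add: K_def power2_eq_square)
  have f_cases: "x = 0 \<and> f x = 0 \<or>
      0 < x \<and> x \<le> k \<and> x - 1 < k \<and> f x = \<pi> (x - 1) + 1 \<and> 0 < f x \<and> f x \<le> k \<and> f x < k^2 + 1 \<or>
      k < x \<and> x - (k + 1) < K \<and> f x = g (x - (k + 1)) + (k + 1) \<and> k < f x \<and> f x < k^2 + 1" if "x < k^2 + 1" for x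
  proof -
    consider "x = 0" | "0 < x" "x \<le> k" | "k < x"
      by linarith
    then show ?thesis
    proof cases
      case 2
      then have "\<pi> (x - 1) < k"
        by (intro \<pi>) simp
      with 2 show ?thesis
        unfolding n by (simp add: f_def)
    next
      case 3
      then have "x - (k + 1) < K"
        using that unfolding n by simp
      with 3 show ?thesis
        using g_lt[of "x - (k + 1)"] unfolding n by (simp add: f_def)
    qed (simp add: f_def)
  qed
  have "p_equivalent (std_form k P) (std_form k P')"
  proof (rule p_equivalent_reindex)
    show "bij_betw f {..<k^2 + 1} {..<k^2 + 1}"
    proof -
      have "f x \<le> k \<longleftrightarrow> x \<le> k" "f x = 0 \<longleftrightarrow> x = 0" "f x < k^2 + 1" if "x < k^2 + 1" for x
        using f_cases[OF that] by auto
      note f_bounds = this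
      have f_inj: "x = y" if "x < k^2 + 1" "y < k^2 + 1" "f x = f y" "x \<le> k \<longleftrightarrow> y \<le> k" "x = 0 \<longleftrightarrow> y = 0" for x y
      proof -
        consider "x = 0" "y = 0" | "0 < x" "x \<le> k" "0 < y" "y \<le> k" | "k < x" "k < y"
          using \<open>x \<le> k \<longleftrightarrow> y \<le> k\<close> \<open>x = 0 \<longleftrightarrow> y = 0\<close> by linarith
        then show ?thesis
        proof cases
          case 2
          then have "\<pi> (x - 1) = \<pi> (y - 1)" "x - 1 < k" "y - 1 < k"
            using that(3) by (auto simp: f_def)
          then have "x - 1 = y - 1"
            using \<pi>(2) by metis
          with 2 show ?thesis
            by simp
        next
          case 3
          then have "g (x - (k + 1)) = g (y - (k + 1))" "x - (k + 1) < K" "y - (k + 1) < K"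
            using that(1-3) unfolding n by (auto simp: f_def)
          then have "x - (k + 1) = y - (k + 1)"
            using g_bij by (auto simp: bij_betw_def inj_on_def)
          with 3 show ?thesis
            by simp
        qed simp
      qed
      have "inj_on f {..<k^2 + 1}"
      proof (rule inj_onI)
        fix x y
        assume "x \<in> {..<k^2 + 1}" "y \<in> {..<k^2 + 1}" and eq: "f x = f y"
        then have lt: "x < k^2 + 1" "y < k^2 + 1"
          by simp_all
        show "x = y"
          using f_inj[OF lt eq] f_bounds(1,2)[OF lt(1)] f_bounds(1,2)[OF lt(2)] eq by metis
      qed
      moreover have "f ` {..<k^2 + 1} \<subseteq> {..<k^2 + 1}"
        using f_bounds(3) by blast
      ultimately show ?thesis
        by (simp add: bij_betw_def endo_inj_surj)
    qed
    fix x y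
    assume xy: "x < k^2 + 1" "y < k^2 + 1"
    have fxy: "f x < k^2 + 1" "f y < k^2 + 1"
      using f_cases[OF xy(1)] f_cases[OF xy(2)] by auto
    have inj: "\<pi> a = \<pi> b \<longleftrightarrow> a = b" if "a < k" "b < k" for a b
      using \<pi>(2) that by metis
    have cell: "g a div (k - 1) = \<pi> b \<longleftrightarrow> a div (k - 1) = b" if "a < K" "b < k" for a b
      using g_div[OF that(1)] inj[OF div_lt[OF that(1)] that(2)] by (simp add: m_def)
    show "std_form k P' $$ (x, y) = std_form k P $$ (f x, f y)"
      unfolding std_form_index[OF P'[unfolded K_def] xy] std_form_index[OF P(1)[unfolded K_def] fxy]
      using f_cases[OF xy(1)] f_cases[OF xy(2)] cell P'_idx by (elim disjE conjE) simp_all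
  qed (rule std_form_carrier P(1)[unfolded K_def] P'[unfolded K_def])+
  moreover have entry: "block k P' 0 j $$ (a, b) = block k P i (\<pi> j) $$ (a, s j b)" if "j < k" "a < m" "b < m" for j a b
  proof -
    have "P' $$ (0 * m + a, j * m + b) = P $$ (g (0 * m + a), g (j * m + b))"
      using that i block_position_less[of 0 k a] block_position_less[of j k b] by (intro P'_idx) (auto simp: m_def K_def)
    then show ?thesis
      using that s_lt[OF that(1,3)] g[of a 0] g[of b j] s0 by (simp add: m_def \<pi>_def)
  qed
  have "block k P' 0 0 = 0\<^sub>m (k - 1) (k - 1)"
  proof (rule eq_matI)
    fix a b
    assume "a < dim_row (0\<^sub>m (k - 1) (k - 1) :: int mat)" "b < dim_col (0\<^sub>m (k - 1) (k - 1) :: int mat)"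
    then have "a < m" "b < m"
      by (simp_all add: m_def)
    then have "block k P' 0 0 $$ (a, b) = block k P i i $$ (a, b)"
      using entry[of 0 a b] i s0 by (simp add: \<pi>_def del: block_index)
    then show "block k P' 0 0 $$ (a, b) = 0\<^sub>m (k - 1) (k - 1) $$ (a, b)"
      unfolding zero .
  qed (simp_all add: block_def)
  moreover have id: "block k P' 0 j = 1\<^sub>m (k - 1)" if "j \<in> {1..<k}" for j
  proof (rule eq_matI)
    fix a b
    assume "a < dim_row (1\<^sub>m (k - 1) :: int mat)" "b < dim_col (1\<^sub>m (k - 1) :: int mat)"
    then have "a < m" "b < m" "j < k" "j \<noteq> 0"
      using that by (simp_all add: m_def)
    then show "block k P' 0 j $$ (a, b) = 1\<^sub>m (k - 1) $$ (a, b)"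
      using entry[of j a b] sP[of j a b] by (simp add: m_def del: block_index)
  qed (simp_all add: block_def)
  moreover have "block k P' j 0 = 1\<^sub>m (k - 1)" if "j \<in> {1..<k}" for j
    using block_transpose[OF P'_param, of 0 j] id[OF that] that i by simp
  ultimately show ?thesis
    using P'_param by blast
qed

end

section \<open>Existence of a vertex in no triangle, and the labelling around it\<close>

context C4_free_regular_graph
begin

lemma triangle_free_vertex:
  assumes k: "1 \<le> k" "k \<le> 4" and n: "n = k^2 + 1"
    and far_C4_free: "\<And>x y a b. \<lbrakk>far x a; far x b; far y a; far y b; x \<noteq> y\<rbrakk> \<Longrightarrow> a = b"
  shows "\<exists>v<n. triangles_at v = {}"
proof (rule ccontr)
  assume *: "\<not> (\<exists>v<n. triangles_at v = {})"
  then have "k \<noteq> 4"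
    using quartic_triangle_free_vertex far_C4_free n by force
  have pos: "card (triangles_at v) \<ge> 1" if "v < n" for v
    using * that by (simp add: Suc_le_eq card_gt_0_iff)
  moreover have "card (triangles_at v) \<le> 1" if "v < n" for v
    using card_triangles_at_le[OF that] k \<open>k \<noteq> 4\<close> by linarith
  ultimately have "card (triangles_at v) = 1" if "v < n" for v
    using that by (simp add: le_antisym)
  then have "n = 3 * card triangles"
    using sum_card_triangles_at by simp
  moreover have "k = 1 \<or> k = 2 \<or> k = 3"
    using k \<open>k \<noteq> 4\<close> by linarith
  \<comment> \<open>A triangle at vertex 0 would need two neighbours.\<close>
  moreover have "k \<noteq> 1"
    using card_triangles_at_le[of 0] pos[of 0] n by auto
  ultimately show False
    using n by (auto; presburger)
qed

text \<open>The labels list \<open>v\<close>, its \<open>k\<close> neighbours, and then for each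
  neighbour in turn its \<open>k - 1\<close> neighbours other than \<open>v\<close>. The lists do
  not overlap, because neighbours of \<open>v\<close> are never adjacent and two of them share only
  \<open>v\<close>; injectivity on \<open>n\<close> labels already makes \<open>f\<close> a
  bijection.\<close>

lemma obtain_labelling:
  assumes v: "v < n" "triangles_at v = {}" and n: "n = k^2 + 1" and k: "1 \<le> k"
  obtains f where "bij_betw f {..<n} {..<n}"
    and "\<And>i. i < n \<Longrightarrow> E (f 0) (f i) \<longleftrightarrow> 0 < i \<and> i \<le> k"
    and "\<And>i j. \<lbrakk>0 < i; i \<le> k; 0 < j; j \<le> k\<rbrakk> \<Longrightarrow> \<not> E (f i) (f j)"
    and "\<And>i x. \<lbrakk>0 < i; i \<le> k; k < x; x < n\<rbrakk> \<Longrightarrow> E (f i) (f x) \<longleftrightarrow> (x - (k + 1)) div (k - 1) = i - 1"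
proof -
  have no_triangle: "\<not> E x y" if "E v x" "E v y" for x y
    using triangles_atI[OF that] v by blast
  obtain g where g: "bij_betw g {..<k} {y. E v y}"
    using ex_bij_betw_nat_finite[OF finite_nbrs, of v] deg[OF v(1)] by (auto simp: lessThan_atLeast0)
  have gE: "E v (g i)" if "i < k" for i
    using bij_betwE[OF g] that by blast
  have g_inj: "g i = g j \<longleftrightarrow> i = j" if "i < k" "j < k" for i j
    using g that by (auto simp: bij_betw_def inj_on_def)
  have "\<forall>u\<in>{y. E v y}. \<exists>h. bij_betw h {..<k - 1} ({y. E u y} - {v})"
  proof
    fix u
    assume "u \<in> {y. E v y}"
    then have "E u v" "u < n"
      using sym vertex by auto
    then have "card ({y. E u y} - {v}) = k - 1"
      using deg by simp
    then show "\<exists>h. bij_betw h {..<k - 1} ({y. E u y} - {v})"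
      using ex_bij_betw_nat_finite[of "{y. E u y} - {v}"] by (auto simp: lessThan_atLeast0)
  qed
  then have "\<exists>h. \<forall>u\<in>{y. E v y}. bij_betw (h u) {..<k - 1} ({y. E u y} - {v})"
    by (rule bchoice)
  then obtain h where h: "bij_betw (h u) {..<k - 1} ({y. E u y} - {v})" if "E v u" for u
    by blast
  define f where "f x = (if x = 0 then v else if x \<le> k then g (x - 1)
    else h (g ((x - (k + 1)) div (k - 1))) ((x - (k + 1)) mod (k - 1)))" for x
  have f0: "f 0 = v"
    by (simp add: f_def)
  have f1: "E v (f i)" "f i = g (i - 1)" if "0 < i" "i \<le> k" for i
    using that gE[of "i - 1"] by (auto simp: f_def)
  have f2: "f x = h (g q) r" "q < k" "r < k - 1" "E (g q) (f x)" "f x \<noteq> v" "\<not> E v (f x)"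
    if "k < x" "x < n" and q: "q = (x - (k + 1)) div (k - 1)" and r: "r = (x - (k + 1)) mod (k - 1)" for x q r
  proof -
    have "x - (k + 1) < k * (k - 1)"
      using that(1,2) n unfolding square_minus_self[symmetric] by linarith
    then have "0 < k - 1"
      by (cases "k - 1 = 0") auto
    then show r_lt: "r < k - 1"
      using r by simp
    show q_lt: "q < k"
      using \<open>x - (k + 1) < k * (k - 1)\<close> q by (simp add: less_mult_imp_div_less)
    show fx: "f x = h (g q) r"
      using that(1) q r by (simp add: f_def)
    have "h (g q) r \<in> {y. E (g q) y} - {v}"
      using bij_betwE[OF h[OF gE[OF q_lt]]] r_lt by blast
    then show "E (g q) (f x)" "f x \<noteq> v"
      unfolding fx by auto
    then show "\<not> E v (f x)"
      using no_triangle gE[OF q_lt] by blast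
  qed
  have cell: "E (f i) (f x) \<longleftrightarrow> (x - (k + 1)) div (k - 1) = i - 1" if "0 < i" "i \<le> k" "k < x" "x < n" for i x
  proof -
    define q where "q = (x - (k + 1)) div (k - 1)"
    note fx = f2[OF that(3,4) q_def refl]
    have i: "i - 1 < k" "f i = g (i - 1)"
      using that f1 by auto
    \<comment> \<open>If \<open>f x\<close> were adjacent to two neighbours of \<open>v\<close>,
      these would have both \<open>v\<close> and \<open>f x\<close> in common.\<close>
    have "q = i - 1" if "E (g (i - 1)) (f x)"
      using C4_free[OF sym[OF gE[OF i(1)]] that sym[OF gE[OF fx(2)]] fx(4)] fx(5) g_inj[OF i(1) fx(2)] by auto
    then show ?thesis
      using i fx(4) unfolding q_def[symmetric] by auto
  qed
  \<comment> \<open>The three ranges of labels go to distance 0, 1 and more than 1 from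
    \<open>v\<close>, so equal values can occur only within one range.\<close>
  have level: "x = 0 \<and> f x = v \<or> 0 < x \<and> x \<le> k \<and> f x \<noteq> v \<and> E v (f x) \<or> k < x \<and> f x \<noteq> v \<and> \<not> E v (f x)"
    if "x < n" for x
  proof -
    consider "x = 0" | "0 < x" "x \<le> k" | "k < x"
      by linarith
    then show ?thesis
    proof cases
      case 2
      then show ?thesis
        using f1 irr by metis
    next
      case 3
      then show ?thesis
        using f2[OF 3 that refl refl] by blast
    qed (simp add: f0)
  qed
  have "inj_on f {..<n}"
  proof (rule inj_onI)
    fix x y
    assume "x \<in> {..<n}" "y \<in> {..<n}" and eq: "f x = f y"
    then have lt: "x < n" "y < n"
      by simp_all
    consider "x = 0" "y = 0" | "0 < x" "x \<le> k" "0 < y" "y \<le> k" | "k < x" "k < y"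
      using level[OF lt(1)] level[OF lt(2)] eq by metis
    then show "x = y"
    proof cases
      case 2
      then have "g (x - 1) = g (y - 1)"
        using f1 eq by metis
      then have "x - 1 = y - 1"
        using g_inj[of "x - 1" "y - 1"] 2 by auto
      with 2 show ?thesis
        by simp
    next
      case 3
      note fx = f2[OF 3(1) lt(1) refl refl] and fy = f2[OF 3(2) lt(2) refl refl]
      have "E (f ((x - (k + 1)) div (k - 1) + 1)) (f y)"
        using fx(2,4) eq by (simp add: f_def)
      then have q: "(y - (k + 1)) div (k - 1) = (x - (k + 1)) div (k - 1)"
        using cell[of "(x - (k + 1)) div (k - 1) + 1" y] fx(2) 3(2) lt(2) by simp
      have "inj_on (h (g ((x - (k + 1)) div (k - 1)))) {..<k - 1}"
        using h[OF gE[OF fx(2)]] by (rule bij_betw_imp_inj_on)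
      then have r: "(x - (k + 1)) mod (k - 1) = (y - (k + 1)) mod (k - 1)"
        using fx(1,3) fy(1,3) eq unfolding q by (metis inj_onD lessThan_iff)
      have "x - (k + 1) = y - (k + 1)"
        using q r by (metis div_mult_mod_eq)
      with 3 show ?thesis
        by simp
    qed simp
  qed
  moreover have "f ` {..<n} \<subseteq> {..<n}"
  proof -
    have "f x < n" if "x < n" for x
      using level[OF that] f2(4)[OF _ that refl refl] v(1) vertex by metis
    then show ?thesis
      by blast
  qed
  ultimately have "bij_betw f {..<n} {..<n}"
    by (simp add: bij_betw_def endo_inj_surj)
  moreover have "E (f 0) (f i) \<longleftrightarrow> 0 < i \<and> i \<le> k" if "i < n" for i
    using level[OF that] irr f0 by auto
  moreover have "\<not> E (f i) (f j)" if "0 < i" "i \<le> k" "0 < j" "j \<le> k" for i j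
    using no_triangle f1 that by blast
  ultimately show thesis
    using cell that by blast
qed

end

section \<open>From the matrix to its graph and back to a standard form\<close>

text \<open>Off the diagonal, an entry of \<open>Theta A\<close> is 1 minus the number of common
  neighbours, so two common neighbours would make it negative.\<close>

lemma adjacency_C4_free_regular_graph:
  fixes k :: nat
  assumes A: "A \<in> carrier_mat n n" "zero_one_mat A" "has_const_sums A (int k)"
    and sym: "\<And>x y. \<lbrakk>x < n; y < n\<rbrakk> \<Longrightarrow> A $$ (x, y) = A $$ (y, x)"
    and diag: "\<And>x. x < n \<Longrightarrow> A $$ (x, x) = 0"
    and Theta: "zero_one_mat (Theta A)"
  shows "C4_free_regular_graph n k (\<lambda>x y. x < n \<and> y < n \<and> A $$ (x, y) = 1)"
proof
  have zero_one: "A $$ (x, y) = 0 \<or> A $$ (x, y) = 1" if "x < n" "y < n" for x y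
    using A that zero_one_mat_iff by blast
  show "card {y. x < n \<and> y < n \<and> A $$ (x, y) = 1} = k" if "x < n" for x
  proof -
    have "int (card {y. y < n \<and> A $$ (x, y) = 1}) = (\<Sum>y<n. A $$ (x, y))"
      using zero_one that by (simp add: sum_zero_one)
    also have "\<dots> = int k"
      using A that by (auto simp: has_const_sums_def)
    finally show ?thesis
      using that by simp
  qed
  show "a = b" if xy: "x < n \<and> a < n \<and> A $$ (x, a) = 1" "x < n \<and> b < n \<and> A $$ (x, b) = 1"
    "y < n \<and> a < n \<and> A $$ (y, a) = 1" "y < n \<and> b < n \<and> A $$ (y, b) = 1" "x \<noteq> y" for x y a b
  proof (rule ccontr)
    assume "a \<noteq> b"
    then have "2 = (\<Sum>l\<in>{a, b}. A $$ (x, l) * A $$ (y, l))"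
      using xy by simp
    also have "\<dots> \<le> (\<Sum>l<n. A $$ (x, l) * A $$ (y, l))"
    proof (intro sum_mono2)
      show "0 \<le> A $$ (x, l) * A $$ (y, l)" if "l \<in> {..<n} - {a, b}" for l
        using zero_one[of x l] zero_one[of y l] xy that by auto
    qed (use xy in auto)
    also have "\<dots> = 1 - Theta A $$ (x, y)"
      using Theta_index[OF A(1,3), of x y] xy by simp
    also have "\<dots> \<le> 1"
      using Theta xy zero_one_mat_iff[OF Theta_carrier[OF A(1)]] by force
    finally show False
      by simp
  qed
qed (use sym diag in auto)

lemma sum_lessThan_add: "(\<Sum>j<a + b. h j) = (\<Sum>j<a. h j) + (\<Sum>j<b. h (a + j))" for a b :: nat
  by (induction b) (simp_all add: add.assoc)

lemma block_std_form_exists: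
  fixes k :: nat
  assumes A: "A \<in> carrier_mat n n" "zero_one_mat A" "has_const_sums A (int k)"
    and n: "n = k^2 + 1" and k: "1 \<le> k"
    and graph: "C4_free_regular_graph n k (\<lambda>x y. x < n \<and> y < n \<and> A $$ (x, y) = 1)"
    and v: "v < n" "C4_free_regular_graph.triangles_at n (\<lambda>x y. x < n \<and> y < n \<and> A $$ (x, y) = 1) v = {}"
  shows "\<exists>P. block_std_form_of k A P"
proof -
  define E where "E x y \<longleftrightarrow> x < n \<and> y < n \<and> A $$ (x, y) = 1" for x y
  have E_fold: "(\<lambda>x y. x < n \<and> y < n \<and> A $$ (x, y) = 1) = E"
    by (simp add: E_def fun_eq_iff)
  interpret C4_free_regular_graph n k E
    using graph unfolding E_fold .
  have A_idx: "A $$ (x, y) = (if E x y then 1 else 0)" if "x < n" "y < n" for x y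
  proof -
    have "A $$ (x, y) = 0 \<or> A $$ (x, y) = 1"
      using A(1,2) zero_one_mat_iff that by blast
    then show ?thesis
      using that by (auto simp: E_def)
  qed
  obtain f where f: "bij_betw f {..<n} {..<n}"
    and f0: "\<And>i. i < n \<Longrightarrow> E (f 0) (f i) \<longleftrightarrow> 0 < i \<and> i \<le> k"
    and f1: "\<And>i j. \<lbrakk>0 < i; i \<le> k; 0 < j; j \<le> k\<rbrakk> \<Longrightarrow> \<not> E (f i) (f j)"
    and f2: "\<And>i x. \<lbrakk>0 < i; i \<le> k; k < x; x < n\<rbrakk> \<Longrightarrow> E (f i) (f x) \<longleftrightarrow> (x - (k + 1)) div (k - 1) = i - 1"
    using obtain_labelling[OF v[unfolded E_fold] n k] by blast
  have f_lt: "f x < n" if "x < n" for x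
    using bij_betwE[OF f] that by blast
  have f_inj: "f x = f y \<longleftrightarrow> x = y" if "x < n" "y < n" for x y
    using f that by (auto simp: bij_betw_def inj_on_def)
  define K where "K = k^2 - k"
  have n_eq: "n = k + 1 + K"
    using power2_nat_le_imp_le[of k "k^2"] n by (simp add: K_def power2_eq_square)
  define P where "P = mat K K (\<lambda>(x, y). A $$ (f (k + 1 + x), f (k + 1 + y)))"
  have P: "P \<in> carrier_mat K K"
    by (simp add: P_def)
  have P_idx: "P $$ (x, y) = (if E (f (k + 1 + x)) (f (k + 1 + y)) then 1 else 0)" if "x < K" "y < K" for x y
    using that A_idx f_lt by (simp add: P_def n_eq)
  have std: "std_form k P $$ (i, j) = A $$ (f i, f j)" if ij: "i < n" "j < n" for i j
  proof -
    have "P $$ (i - (k + 1), j - (k + 1)) = (if E (f i) (f j) then 1 else 0)" if "k < i" "k < j"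
      using P_idx[of "i - (k + 1)" "j - (k + 1)"] that ij unfolding n_eq by simp
    then show ?thesis
      unfolding std_form_index[OF P[unfolded K_def] ij[unfolded n]] A_idx[OF f_lt[OF ij(1)] f_lt[OF ij(2)]]
      using f0[OF ij(1)] f0[OF ij(2)] f1[of i j] f2[of i j] f2[of j i] ij E_commute[of "f i" "f j"] by auto
  qed
  have sym_P: "P $$ (x, y) = P $$ (y, x)" if "x < K" "y < K" for x y
    using that E_commute by (simp add: P_idx)
  \<comment> \<open>A vertex with a label beyond \<open>k\<close> is not adjacent to the root and
    has exactly one neighbour among the labels 1 to \<open>k\<close>, which leaves
    \<open>k - 1\<close> ones for its row of \<open>P\<close>.\<close>
  have row: "(\<Sum>y<K. P $$ (x, y)) = int k - 1" if x: "x < K" for x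
  proof -
    define i where "i = k + 1 + x"
    have i: "i < n"
      using x by (simp add: i_def n_eq)
    have div: "x div (k - 1) < k"
      using x by (simp add: K_def square_minus_self less_mult_imp_div_less)
    have "int k = (\<Sum>j<n. A $$ (f i, j))"
      using A f_lt[OF i] by (auto simp: has_const_sums_def)
    also have "\<dots> = (\<Sum>j<n. std_form k P $$ (i, j))"
      unfolding sum.reindex_bij_betw[OF f, of "\<lambda>j. A $$ (f i, j)", symmetric] using std i by simp
    also have "\<dots> = (\<Sum>j<1 + k + K. std_form k P $$ (i, j))"
      by (simp add: n_eq add.commute)
    also have "\<dots> = std_form k P $$ (i, 0) + (\<Sum>j<k. std_form k P $$ (i, 1 + j)) + (\<Sum>y<K. std_form k P $$ (i, 1 + k + y))"
      by (simp only: sum_lessThan_add) simp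
    also have "std_form k P $$ (i, 0) = 0"
      using std_form_index[OF P[unfolded K_def], of i 0] i n by (simp add: i_def)
    also have "(\<Sum>j<k. std_form k P $$ (i, 1 + j)) = (\<Sum>j<k. if j = x div (k - 1) then 1 else 0)"
      using std_form_index[OF P[unfolded K_def], of i] i by (intro sum.cong) (auto simp: i_def n n_eq)
    also have "\<dots> = 1"
      using div by simp
    also have "(\<Sum>y<K. std_form k P $$ (i, 1 + k + y)) = (\<Sum>y<K. P $$ (x, y))"
      using std_form_index[OF P[unfolded K_def], of i] i n n_eq by (intro sum.cong) (auto simp: i_def)
    finally show ?thesis
      by simp
  qed
  moreover have "(\<Sum>x<K. P $$ (x, y)) = int k - 1" if "y < K" for y
    using row[OF that] sym_P that by simp
  ultimately have param: "std_param k P"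
    using P sym_P by (auto simp: std_param_def has_const_sums_def zero_one_mat_iff P_idx K_def[symmetric] intro!: eq_matI)
  moreover have "p_equivalent A (std_form k P)"
    using f A(1) std_form_carrier[OF P[unfolded K_def]] std unfolding n by (rule p_equivalent_reindex)
  moreover have "partial_permutation_mat (block k P i j)" if ij: "i < k" "j < k" for i j
  proof -
    \<comment> \<open>Group \<open>j\<close> consists of neighbours of the vertex labelled
      \<open>j + 1\<close>. Two ones of a row within this group would be two common neighbours of
      that vertex and the one labelled \<open>k + 1 + a\<close>.\<close>
    have unique: "b = b'" if "a < K" "j < k" "b < k - 1" "b' < k - 1"
      "P $$ (a, j * (k - 1) + b) = 1" "P $$ (a, j * (k - 1) + b') = 1" for a b b' j
    proof -
      have lt: "j * (k - 1) + b < K" "j * (k - 1) + b' < K"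
        using block_position_less that by (auto simp: K_def)
      have "E (f (k + 1 + a)) (f (k + 1 + (j * (k - 1) + b)))" "E (f (k + 1 + a)) (f (k + 1 + (j * (k - 1) + b')))"
        using that lt P_idx by (metis zero_neq_one)+
      moreover have "E (f (j + 1)) (f (k + 1 + (j * (k - 1) + b)))" "E (f (j + 1)) (f (k + 1 + (j * (k - 1) + b')))"
        using f2[of "j + 1"] that lt by (auto simp: n_eq)
      moreover have "f (k + 1 + a) \<noteq> f (j + 1)"
        using f_inj[of "k + 1 + a" "j + 1"] that n_eq by auto
      ultimately have "f (k + 1 + (j * (k - 1) + b)) = f (k + 1 + (j * (k - 1) + b'))"
        by (rule C4_free)
      then show ?thesis
        using f_inj lt by (simp add: n_eq)
    qed
    have lt: "i * (k - 1) + a < K" "j * (k - 1) + a < K" if "a < k - 1" for a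
      using block_position_less that ij by (auto simp: K_def)
    have "zero_one_mat (block k P i j)"
      using lt P_idx by (subst zero_one_mat_iff[OF block_carrier]) auto
    moreover have "card {b. b < k - 1 \<and> block k P i j $$ (a, b) = 1} \<le> Suc 0" if a: "a < k - 1" for a
      using unique[OF lt(1)[OF a] ij(2)] a by (subst card_le_Suc0_iff_eq) auto
    moreover have "card {a. a < k - 1 \<and> block k P i j $$ (a, b) = 1} \<le> Suc 0" if b: "b < k - 1" for b
      using unique[OF lt(2)[OF b] ij(1)] b lt sym_P by (subst card_le_Suc0_iff_eq) auto
    ultimately show ?thesis
      by (simp add: partial_permutation_mat_def block_def)
  qed
  ultimately show ?thesis
    unfolding block_std_form_of_def by blast
qed

theorem theorem3p5:
  fixes \<kappa> :: nat and A :: "int mat"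
  assumes "1 \<le> \<kappa>" and "\<kappa> \<le> 4"
    and "A \<in> carrier_mat (\<kappa>^2 + 1) (\<kappa>^2 + 1)"
    and "zero_one_mat A"
    and "has_const_sums A (int \<kappa>)"
    and "\<exists>m \<ge> 1. (Theta ^^ m) A = A"
  shows
    "(\<exists>P. block_std_form_of \<kappa> A P) \<and>
     (\<forall>P. block_std_form_of \<kappa> A P \<longrightarrow>
        (\<forall>i < \<kappa>. \<forall>j < \<kappa>. block \<kappa> P i j = 0\<^sub>m (\<kappa> - 1) (\<kappa> - 1) \<longrightarrow>
           (\<forall>j' < \<kappa>. j' \<noteq> j \<longrightarrow> permutation_mat (\<kappa> - 1) (block \<kappa> P i j')) \<and>
           (\<forall>i' < \<kappa>. i' \<noteq> i \<longrightarrow> permutation_mat (\<kappa> - 1) (block \<kappa> P i' j)))) \<and>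
     (\<forall>P. block_std_form_of \<kappa> A P \<and>
          (\<exists>i < \<kappa>. block \<kappa> P i i = 0\<^sub>m (\<kappa> - 1) (\<kappa> - 1)) \<longrightarrow>
        (\<exists>P'. std_param \<kappa> P' \<and> p_equivalent A (std_form \<kappa> P') \<and>
           block \<kappa> P' 0 0 = 0\<^sub>m (\<kappa> - 1) (\<kappa> - 1) \<and>
           (\<forall>i \<in> {1..<\<kappa>}. block \<kappa> P' 0 i = 1\<^sub>m (\<kappa> - 1) \<and> block \<kappa> P' i 0 = 1\<^sub>m (\<kappa> - 1))))"
proof (intro conjI allI impI)
  define n where "n = \<kappa>^2 + 1"
  obtain m where m: "m \<ge> 1" "(Theta ^^ m) A = A"
    using assms(6) by blast
  have A: "A \<in> carrier_mat n n" "has_const_sums A (int \<kappa>)" "int n = (int \<kappa>)^2 + 1" "zero_one_mat A"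
    using assms by (simp_all add: n_def)
  note zero_one = periodic_orbit_zero_one[OF A m]
  note orbit = Theta_orbit_carrier[OF A(1-3)]
  \<comment> \<open>Images under \<open>Theta\<close> are symmetric, and their diagonal vanishes
    because the preimage is (0,1); that the next iterate is (0,1) excludes 4-cycles.\<close>
  have graph: "C4_free_regular_graph n \<kappa> (\<lambda>x y. x < n \<and> y < n \<and> Theta ((Theta ^^ j) A) $$ (x, y) = 1)" for j
  proof (rule adjacency_C4_free_regular_graph)
    show "Theta ((Theta ^^ j) A) \<in> carrier_mat n n" "has_const_sums (Theta ((Theta ^^ j) A)) (int \<kappa>)"
      "zero_one_mat (Theta ((Theta ^^ j) A))" "zero_one_mat (Theta (Theta ((Theta ^^ j) A)))"
      using orbit[of "Suc j"] zero_one[of "Suc j"] zero_one[of "Suc (Suc j)"] by simp_all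
    show "Theta ((Theta ^^ j) A) $$ (x, y) = Theta ((Theta ^^ j) A) $$ (y, x)" if "x < n" "y < n" for x y
      using Theta_symmetric orbit that by blast
    show "Theta ((Theta ^^ j) A) $$ (x, x) = 0" if "x < n" for x
      using Theta_diag(2)[of "(Theta ^^ j) A" n "int \<kappa>" x] orbit[of j] zero_one[of j] that
        zero_one_mat_iff[of "(Theta ^^ j) A" n n] by blast
  qed
  \<comment> \<open>By periodicity \<open>A\<close> is itself the image of iterate
    \<open>m - 1\<close>.\<close>
  have graph_A: "C4_free_regular_graph n \<kappa> (\<lambda>x y. x < n \<and> y < n \<and> A $$ (x, y) = 1)"
    using graph[of "m - 1"] m by (cases m) simp_all
  have graph_Theta: "C4_free_regular_graph n \<kappa> (\<lambda>x y. x < n \<and> y < n \<and> Theta A $$ (x, y) = 1)"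
    using graph[of 0] by simp
  interpret C4_free_regular_graph n \<kappa> "\<lambda>x y. x < n \<and> y < n \<and> A $$ (x, y) = 1"
    by (rule graph_A)
  \<comment> \<open>Without a common neighbour all products in the sum vanish and the entry of
    \<open>Theta A\<close> is 1. Thus \<open>far\<close> inherits the absence of 4-cycles from the
    graph of \<open>Theta A\<close>.\<close>
  have far: "x < n \<and> y < n \<and> Theta A $$ (x, y) = 1" if "far x y" for x y
  proof -
    have xy: "x < n" "y < n" "x \<noteq> y" "\<And>z. z < n \<Longrightarrow> A $$ (x, z) \<noteq> 1 \<or> A $$ (y, z) \<noteq> 1"
      using that by (auto simp: far_def)
    then have "(\<Sum>l<n. A $$ (x, l) * A $$ (y, l)) = 0"
      using A(1,4) by (intro sum.neutral) (auto simp: zero_one_mat_iff[of _ n n])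
    then show ?thesis
      using Theta_index[OF A(1,2) xy(1,2)] xy(1-3) by simp
  qed
  have "\<exists>v<n. triangles_at v = {}"
    using C4_free_regular_graph.C4_free[OF graph_Theta] far
    by (intro triangle_free_vertex assms(1,2) n_def) blast
  then show "\<exists>P. block_std_form_of \<kappa> A P"
    using block_std_form_exists[OF A(1,4,2) n_def assms(1) graph_A] by blast
next
  fix P i j j'
  assume "block_std_form_of \<kappa> A P" "i < \<kappa>" "j < \<kappa>" "block \<kappa> P i j = 0\<^sub>m (\<kappa> - 1) (\<kappa> - 1)" "j' < \<kappa>" "j' \<noteq> j"
  then show "permutation_mat (\<kappa> - 1) (block \<kappa> P i j')"
    using zero_block_row unfolding block_std_form_of_def by blast
next
  fix P i j i'
  assume "block_std_form_of \<kappa> A P" "i < \<kappa>" "j < \<kappa>" "block \<kappa> P i j = 0\<^sub>m (\<kappa> - 1) (\<kappa> - 1)" "i' < \<kappa>" "i' \<noteq> i"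
  then show "permutation_mat (\<kappa> - 1) (block \<kappa> P i' j)"
    using zero_block_column unfolding block_std_form_of_def by blast
next
  fix P
  assume P: "block_std_form_of \<kappa> A P \<and> (\<exists>i < \<kappa>. block \<kappa> P i i = 0\<^sub>m (\<kappa> - 1) (\<kappa> - 1))"
  then obtain i where "i < \<kappa>" "block \<kappa> P i i = 0\<^sub>m (\<kappa> - 1) (\<kappa> - 1)"
    by blast
  moreover have "std_param \<kappa> P" "p_equivalent A (std_form \<kappa> P)"
    "\<forall>i<\<kappa>. \<forall>j<\<kappa>. partial_permutation_mat (block \<kappa> P i j)"
    using P by (simp_all add: block_std_form_of_def)
  ultimately show "\<exists>P'. std_param \<kappa> P' \<and> p_equivalent A (std_form \<kappa> P') \<and>
           block \<kappa> P' 0 0 = 0\<^sub>m (\<kappa> - 1) (\<kappa> - 1) \<and>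
           (\<forall>i \<in> {1..<\<kappa>}. block \<kappa> P' 0 i = 1\<^sub>m (\<kappa> - 1) \<and> block \<kappa> P' i 0 = 1\<^sub>m (\<kappa> - 1))"
    using normalise_zero_diagonal_block[of \<kappa> P i] p_equivalent_trans[of A "std_form \<kappa> P"] by blast
qed

end
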